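(* Let $m\ge 2$ be an integer and let $H$ be a graph with $\chi(H)=r+1>m$. For every $\varepsilon>0$ there exist $\delta>0$ and $n_0\in\mathbb N$ such that the following holds. If $G$ is an $H$-free graph on $n\ge n_0$ vertices with $\mathcal N(G,K_m)\ge \mathcal N(T_r(n),K_m)-\delta n^m$, then $G$ can be obtained from $T_r(n)$ by adding and deleting a set of at most $\varepsilon n^2$ edges.
   Context: All graphs are finite and simple. $\mathcal N(G,T)$ denotes the number of copies of $T$ in $G$, i.e. the number of (not necessarily induced) subgraphs of $G$ isomorphic to $T$. A graph is $H$-free if it contains no subgraph isomorphic to $H$. The Turán graph $T_r(n)$ is the complete balanced $r$-partite graph on $n$ vertices (part sizes differ by at most one). *)

theory Defs
  imports Complex_Main
begin

datatype 'a graph = Graph (verts: "'a set") (edges: "'a set set")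

definition pairs_of :: "'a set \<Rightarrow> 'a set set" where
  "pairs_of V = {e. e \<subseteq> V \<and> card e = 2}"

definition simple_graph :: "'a graph \<Rightarrow> bool" where
  "simple_graph G \<longleftrightarrow> finite (verts G) \<and> edges G \<subseteq> pairs_of (verts G)"

definition isomorphic :: "'a graph \<Rightarrow> 'b graph \<Rightarrow> bool" where
  "isomorphic G H \<longleftrightarrow>
    (\<exists>f. bij_betw f (verts G) (verts H) \<and>
         (\<forall>u \<in> verts G. \<forall>v \<in> verts G. {u, v} \<in> edges G \<longleftrightarrow> {f u, f v} \<in> edges H))"

definition subgraph :: "'a graph \<Rightarrow> 'a graph \<Rightarrow> bool" where
  "subgraph S G \<longleftrightarrow> simple_graph S \<and> verts S \<subseteq> verts G \<and> edges S \<subseteq> edges G"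

text \<open>The subgraphs need not be induced. The pattern graph may live on a different vertex type.\<close>

definition copies :: "'a graph \<Rightarrow> 'b graph \<Rightarrow> 'a graph set" where
  "copies G T = {S. subgraph S G \<and> isomorphic S T}"

definition num_copies :: "'a graph \<Rightarrow> 'b graph \<Rightarrow> nat" where
  "num_copies G T = card (copies G T)"

definition graph_free :: "'b graph \<Rightarrow> 'a graph \<Rightarrow> bool" where
  "graph_free H G \<longleftrightarrow> \<not> (\<exists>S. subgraph S G \<and> isomorphic S H)"

definition proper_colouring :: "'a graph \<Rightarrow> nat \<Rightarrow> ('a \<Rightarrow> nat) \<Rightarrow> bool" where
  "proper_colouring G k c \<longleftrightarrow>
    (\<forall>v \<in> verts G. c v < k) \<and>
    (\<forall>u \<in> verts G. \<forall>v \<in> verts G. {u, v} \<in> edges G \<longrightarrow> c u \<noteq> c v)"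

definition chromatic_number :: "'a graph \<Rightarrow> nat" where
  "chromatic_number G = (LEAST k. \<exists>c. proper_colouring G k c)"

definition complete_graph :: "nat \<Rightarrow> nat graph" where
  "complete_graph m = Graph {..<m} (pairs_of {..<m})"

text \<open>The parts of the Turan graph are the residue classes modulo \<open>r\<close>; for \<open>r > 0\<close> these
  are \<open>r\<close> (possibly empty) parts whose sizes differ by at most one, as
  \<open>turan_parts_balanced\<close> confirms.\<close>

definition turan_part :: "nat \<Rightarrow> nat \<Rightarrow> nat \<Rightarrow> nat set" where
  "turan_part r n i = {v. v < n \<and> v mod r = i}"

definition turan_graph :: "nat \<Rightarrow> nat \<Rightarrow> nat graph" where
  "turan_graph r n = Graph {..<n} {{u, v} | u v. u < n \<and> v < n \<and> u mod r \<noteq> v mod r}"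

text \<open>\<open>obtained_by_edits T G k\<close>: up to isomorphism, \<open>G\<close> arises from \<open>T\<close> by adding the non-edges
  in \<open>A\<close> and deleting the edges in \<open>D\<close>, with at most \<open>k\<close> changes in total.\<close>

definition obtained_by_edits :: "'a graph \<Rightarrow> 'b graph \<Rightarrow> real \<Rightarrow> bool" where
  "obtained_by_edits T G k \<longleftrightarrow>
    (\<exists>A D. A \<subseteq> pairs_of (verts T) - edges T \<and> D \<subseteq> edges T \<and>
           real (card (A \<union> D)) \<le> k \<and>
           isomorphic (Graph (verts T) ((edges T \<union> A) - D)) G)"

lemma simple_turan_graph: "simple_graph (turan_graph r n)"
  by (auto simp: simple_graph_def turan_graph_def pairs_of_def card_insert_if)

lemma chromatic_number_proper:
  assumes "simple_graph G"
  shows "\<exists>c. proper_colouring G (chromatic_number G) c"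
proof -
  have fin: "finite (verts G)" using assms by (simp add: simple_graph_def)
  obtain c where c: "bij_betw c (verts G) {0..<card (verts G)}"
    using ex_bij_betw_finite_nat[OF fin] by blast
  have "c u \<noteq> c v" if "u \<in> verts G" "v \<in> verts G" "{u, v} \<in> edges G" for u v
  proof
    assume "c u = c v"
    hence "u = v" using c that by (auto simp: bij_betw_def inj_on_def)
    moreover have "card {u, v} = 2"
      using assms that by (auto simp: simple_graph_def pairs_of_def)
    ultimately show False by simp
  qed
  moreover have "c v < card (verts G)" if "v \<in> verts G" for v
    using c that by (auto simp: bij_betw_def)
  ultimately have "proper_colouring G (card (verts G)) c"
    by (auto simp: proper_colouring_def)
  hence "\<exists>c. proper_colouring G (card (verts G)) c" by blast
  thus ?thesis unfolding chromatic_number_def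
    by (rule LeastI[where P = "\<lambda>k. \<exists>c. proper_colouring G k c"])
qed

lemma turan_part_card:
  assumes "i < r"
  shows "card (turan_part r n i) = n div r + (if i < n mod r then 1 else 0)"
proof (induction n)
  case 0
  then show ?case by (simp add: turan_part_def)
next
  case (Suc n)
  have fin: "finite (turan_part r n i)" by (simp add: turan_part_def)
  have "turan_part r (Suc n) i =
      (if n mod r = i then insert n (turan_part r n i) else turan_part r n i)"
    by (auto simp: turan_part_def less_Suc_eq)
  moreover have "n \<notin> turan_part r n i" by (simp add: turan_part_def)
  ultimately have *: "card (turan_part r (Suc n) i) =
      card (turan_part r n i) + (if n mod r = i then 1 else 0)" using fin by simp
  show ?case
  proof (cases "Suc (n mod r) = r")
    case True
    then show ?thesis using * Suc assms by (auto simp: div_Suc mod_Suc)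
  next
    case False
    then show ?thesis using * Suc assms by (auto simp: div_Suc mod_Suc)
  qed
qed

lemma turan_parts_balanced:
  assumes "i < r" "j < r"
  shows "card (turan_part r n i) \<le> card (turan_part r n j) + 1"
  using assms by (simp add: turan_part_card)

lemma turan_graph_edge_iff:
  "{u, v} \<in> edges (turan_graph r n) \<longleftrightarrow> u < n \<and> v < n \<and> u mod r \<noteq> v mod r"
  by (auto simp: turan_graph_def doubleton_eq_iff)

end

theory Submission
  imports Defs "HOL-Analysis.Convex"
begin

text \<open>
  The proof reduces the statement to a property of the clique densities \<open>\<tau>\<^sub>s\<close>, the probability
  that \<open>s\<close> random vertices of \<open>G\<close> form a clique, and thereby avoids the regularity lemma.

  Write \<open>T\<^sub>s\<close> for the limit of these densities in the Turan graphs \<open>T\<^sub>r(n)\<close>.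
  Because \<open>H\<close> is \<open>(r+1)\<close>-colourable, it is contained in every complete \<open>(r+1)\<close>-partite graph with
  large parts, and a positive density of \<open>K\<^bsub>r+1\<^esub>\<close> would force such a subgraph. Hence \<open>\<tau>\<^bsub>r+1\<^esub> = o(1)\<close>
  for \<open>H\<close>-free graphs (\<open>graph_free_few_cliques\<close>).

  The Moon--Moser inequalities relate \<open>\<tau>\<^sub>s\<close>, \<open>\<tau>\<^bsub>s+1\<^esub>\<close> and \<open>\<tau>\<^bsub>s+2\<^esub>\<close> for every graph. Together with
  \<open>\<tau>\<^bsub>r+1\<^esub> = o(1)\<close> they bound each ratio \<open>\<tau>\<^bsub>s+1\<^esub> / \<tau>\<^sub>s\<close> by its value in the Turan graph, up to \<open>o(1)\<close>.
  If \<open>\<tau>\<^sub>m\<close>, which is a product of such ratios, is almost as large as \<open>T\<^sub>m\<close>, then all these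
  bounds are almost tight, first for \<open>s \<le> m\<close> and then, by the inequalities again, for all \<open>s \<le> r\<close>.
  So \<open>\<tau>\<^sub>s = T\<^sub>s + o(1)\<close> for all \<open>s \<le> r\<close> (\<open>density_near_turan\<close>).

  Finally, an average \<open>r\<close>-clique \<open>Q\<close> reveals the parts: because \<open>\<tau>\<^sub>r / \<tau>\<^bsub>r-1\<^esub>\<close> is almost \<open>1/r\<close> and there are
  few \<open>(r+1)\<close>-cliques, almost every vertex misses exactly one element \<open>v\<close> of \<open>Q\<close>. Two adjacent vertices
  that both miss \<open>v\<close> would form a \<open>K\<^bsub>r+1\<^esub>\<close> with \<open>Q - {v}\<close>, which is rare. Thus \<open>Q\<close> induces an almost proper
  \<open>r\<close>-colouring of \<open>G\<close> (\<open>good_clique_exists\<close>, \<open>clique_colouring\<close>). As \<open>\<tau>\<^sub>2\<close> is close to \<open>T\<^sub>2\<close>,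
  the colour classes are almost equal in size and almost completely joined to each other
  (\<open>obtained_by_edits_if_few_mono_edges\<close>).
\<close>

section \<open>Cliques\<close>

definition cliques :: "'a graph \<Rightarrow> nat \<Rightarrow> 'a set set" where
  "cliques G s = {Q. Q \<subseteq> verts G \<and> card Q = s \<and> pairs_of Q \<subseteq> edges G}"

definition common_nbrs :: "'a graph \<Rightarrow> 'a set \<Rightarrow> 'a set" where
  "common_nbrs G Q = {w \<in> verts G. \<forall>v\<in>Q. {v, w} \<in> edges G}"

lemma finite_cliques: "simple_graph G \<Longrightarrow> finite (cliques G s)"
  by (rule finite_subset[of _ "Pow (verts G)"]) (auto simp: cliques_def simple_graph_def)

lemma finite_clique: "simple_graph G \<Longrightarrow> Q \<in> cliques G s \<Longrightarrow> finite Q"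
  by (auto simp: cliques_def simple_graph_def intro: finite_subset)

lemma finite_common_nbrs: "simple_graph G \<Longrightarrow> finite (common_nbrs G Q)"
  by (auto simp: common_nbrs_def simple_graph_def)

lemma edge_distinct: "simple_graph G \<Longrightarrow> {u, v} \<in> edges G \<Longrightarrow> u \<noteq> v"
  by (auto simp: simple_graph_def pairs_of_def)

lemma finite_edges: "simple_graph G \<Longrightarrow> finite (edges G)"
  by (rule finite_subset[of _ "Pow (verts G)"]) (auto simp: simple_graph_def pairs_of_def)

lemma pairs_of_iff: "e \<in> pairs_of V \<longleftrightarrow> (\<exists>u\<in>V. \<exists>v\<in>V. u \<noteq> v \<and> e = {u, v})"
  by (auto simp: pairs_of_def card_2_iff)

lemma pairs_of_subset_iff:
  "pairs_of Q \<subseteq> E \<longleftrightarrow> (\<forall>u\<in>Q. \<forall>v\<in>Q. u \<noteq> v \<longrightarrow> {u, v} \<in> E)"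
  by (auto simp: pairs_of_iff subset_iff)

lemma common_nbr_notin: "simple_graph G \<Longrightarrow> v \<in> common_nbrs G Q \<Longrightarrow> v \<notin> Q"
  using edge_distinct by (fastforce simp: common_nbrs_def)

lemma clique_insert:
  assumes "simple_graph G" "Q \<in> cliques G s" "v \<in> common_nbrs G Q"
  shows "insert v Q \<in> cliques G (Suc s)"
  using assms common_nbr_notin[OF assms(1,3)] finite_clique[OF assms(1,2)]
  by (auto simp: cliques_def common_nbrs_def pairs_of_subset_iff insert_commute)

lemma clique_remove:
  assumes "simple_graph G" "Q \<in> cliques G (Suc s)" "v \<in> Q"
  shows "Q - {v} \<in> cliques G s" "v \<in> common_nbrs G (Q - {v})"
  using assms finite_clique[OF assms(1,2)]
  by (auto simp: cliques_def common_nbrs_def pairs_of_subset_iff)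

lemma cliques_0: "simple_graph G \<Longrightarrow> cliques G 0 = {{}}"
proof -
  assume G: "simple_graph G"
  have "Q = {}" if "Q \<in> cliques G 0" for Q
    using finite_clique[OF G that] that by (simp add: cliques_def)
  moreover have "{} \<in> cliques G 0" by (auto simp: cliques_def pairs_of_def)
  ultimately show ?thesis by blast
qed

lemma cliques_2: "simple_graph G \<Longrightarrow> cliques G 2 = edges G"
proof -
  assume G: "simple_graph G"
  have pairs: "pairs_of e = {e}" if "card e = 2" for e :: "'a set"
  proof -
    have "finite e" using that by (metis card.infinite zero_neq_numeral)
    thus ?thesis using that card_subset_eq[of e] by (auto simp: pairs_of_def)
  qed
  have "cliques G 2 = {e. e \<subseteq> verts G \<and> card e = 2 \<and> e \<in> edges G}"
    unfolding cliques_def by (intro Collect_cong) (use pairs in auto)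
  also have "\<dots> = edges G" using G by (auto simp: simple_graph_def pairs_of_def)
  finally show ?thesis .
qed

text \<open>An \<open>(s+1)\<close>-clique with a marked vertex is the same thing as an \<open>s\<close>-clique with a vertex
  joined to all of it.\<close>

lemma sum_flags:
  fixes g :: "'a set \<Rightarrow> 'a \<Rightarrow> 'b::comm_monoid_add"
  assumes G: "simple_graph G"
  shows "(\<Sum>P\<in>cliques G s. \<Sum>v\<in>common_nbrs G P. g P v) =
         (\<Sum>Q\<in>cliques G (Suc s). \<Sum>v\<in>Q. g (Q - {v}) v)"
proof -
  have "(\<Sum>P\<in>cliques G s. \<Sum>v\<in>common_nbrs G P. g P v) =
        (\<Sum>(P, v)\<in>(SIGMA P:cliques G s. common_nbrs G P). g P v)"
    by (rule sum.Sigma) (auto simp: finite_cliques finite_common_nbrs G)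
  also have "\<dots> = (\<Sum>(Q, v)\<in>(SIGMA Q:cliques G (Suc s). Q). g (Q - {v}) v)"
    by (rule sum.reindex_bij_witness[where i = "\<lambda>(Q, v). (Q - {v}, v)"
          and j = "\<lambda>(P, v). (insert v P, v)"])
       (auto simp: clique_insert[OF G] clique_remove[OF G] insert_absorb
          dest: common_nbr_notin[OF G])
  also have "\<dots> = (\<Sum>Q\<in>cliques G (Suc s). \<Sum>v\<in>Q. g (Q - {v}) v)"
    by (rule sum.Sigma[symmetric]) (auto simp: finite_cliques G intro: finite_clique[OF G])
  finally show ?thesis .
qed

lemma sum_card_common_nbrs:
  assumes G: "simple_graph G"
  shows "(\<Sum>P\<in>cliques G s. card (common_nbrs G P)) = Suc s * card (cliques G (Suc s))"
proof -
  have "(\<Sum>P\<in>cliques G s. card (common_nbrs G P)) = (\<Sum>Q\<in>cliques G (Suc s). card Q)"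
    using sum_flags[OF G, where g = "\<lambda>_ _. 1::nat"] by simp
  also have "\<dots> = (\<Sum>Q\<in>cliques G (Suc s). Suc s)"
    by (rule sum.cong) (auto simp: cliques_def)
  finally show ?thesis by simp
qed

lemma card_cliques_1: "simple_graph G \<Longrightarrow> card (cliques G 1) = card (verts G)"
proof -
  assume G: "simple_graph G"
  with sum_card_common_nbrs[OF G, of 0] cliques_0[OF G] show ?thesis
    by (simp add: common_nbrs_def)
qed

lemma card_cliques_Suc_le:
  assumes G: "simple_graph G"
  shows "Suc s * card (cliques G (Suc s)) \<le> card (verts G) * card (cliques G s)"
proof -
  have "(\<Sum>P\<in>cliques G s. card (common_nbrs G P)) \<le> (\<Sum>P\<in>cliques G s. card (verts G))"
    by (rule sum_mono) (use G in \<open>auto simp: common_nbrs_def simple_graph_def intro!: card_mono\<close>)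
  thus ?thesis by (simp add: sum_card_common_nbrs[OF G] mult.commute)
qed

lemma fact_cliques_le:
  assumes G: "simple_graph G"
  shows "fact s * card (cliques G s) \<le> card (verts G) ^ s"
proof (induction s)
  case 0
  then show ?case by (simp add: cliques_0[OF G])
next
  case (Suc s)
  have "fact (Suc s) * card (cliques G (Suc s)) = fact s * (Suc s * card (cliques G (Suc s)))"
    by (simp add: algebra_simps)
  also have "\<dots> \<le> fact s * (card (verts G) * card (cliques G s))"
    by (rule mult_left_mono[OF card_cliques_Suc_le[OF G]]) simp
  also have "\<dots> \<le> card (verts G) * card (verts G) ^ s"
    using mult_left_mono[OF Suc, of "card (verts G)"] by (simp add: algebra_simps)
  finally show ?case by simp
qed

text \<open>A copy of \<open>K\<^sub>m\<close> has no choice of edges left once its vertex set is known.\<close>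

lemma num_copies_complete_graph:
  assumes G: "simple_graph G"
  shows "num_copies G (complete_graph m) = card (cliques G m)"
proof -
  have "bij_betw verts (copies G (complete_graph m)) (cliques G m)"
  proof (rule bij_betw_byWitness[where f' = "\<lambda>Q. Graph Q (pairs_of Q)"])
    have *: "edges S = pairs_of (verts S) \<and> card (verts S) = m"
      if S: "simple_graph S" and iso: "isomorphic S (complete_graph m)" for S :: "'a graph"
    proof -
      obtain f where f: "bij_betw f (verts S) {..<m}"
        and E: "\<And>u v. u \<in> verts S \<Longrightarrow> v \<in> verts S \<Longrightarrow>
                  {u, v} \<in> edges S \<longleftrightarrow> {f u, f v} \<in> pairs_of {..<m}"
        using iso by (auto simp: isomorphic_def complete_graph_def)
      have "{u, v} \<in> edges S" if "u \<in> verts S" "v \<in> verts S" "u \<noteq> v" for u v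
      proof -
        have "f u \<noteq> f v" using that f by (auto simp: bij_betw_def inj_on_def)
        moreover have "f u < m" "f v < m" using that f by (auto simp: bij_betw_def)
        ultimately show ?thesis using that by (auto simp: E pairs_of_def card_insert_if)
      qed
      hence "pairs_of (verts S) \<subseteq> edges S" by (auto simp: pairs_of_subset_iff)
      with S bij_betw_same_card[OF f] show ?thesis by (auto simp: simple_graph_def)
    qed
    show "\<forall>S\<in>copies G (complete_graph m). Graph (verts S) (pairs_of (verts S)) = S"
      using * by (metis (mono_tags, lifting) copies_def graph.collapse mem_Collect_eq subgraph_def)
    show "\<forall>Q\<in>cliques G m. verts (Graph Q (pairs_of Q)) = Q" by simp
    show "verts ` copies G (complete_graph m) \<subseteq> cliques G m"
      using * by (fastforce simp: copies_def subgraph_def cliques_def)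
    show "(\<lambda>Q. Graph Q (pairs_of Q)) ` cliques G m \<subseteq> copies G (complete_graph m)"
    proof clarify
      fix Q assume Q: "Q \<in> cliques G m"
      have fin: "finite Q" using finite_clique[OF G Q] .
      obtain f where f: "bij_betw f Q {..<m}"
        using ex_bij_betw_finite_nat[OF fin] Q by (auto simp: cliques_def atLeast0LessThan)
      have "{u, v} \<in> pairs_of Q \<longleftrightarrow> {f u, f v} \<in> pairs_of {..<m}" if "u \<in> Q" "v \<in> Q" for u v
      proof -
        have "f u = f v \<longleftrightarrow> u = v" using f that by (auto simp: bij_betw_def inj_on_def)
        moreover have "f u < m" "f v < m" using f that by (auto simp: bij_betw_def)
        ultimately show ?thesis using that by (auto simp: pairs_of_def card_insert_if)
      qed
      with f Q fin show "Graph Q (pairs_of Q) \<in> copies G (complete_graph m)"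
        by (auto simp: copies_def subgraph_def isomorphic_def complete_graph_def cliques_def
              simple_graph_def)
    qed
  qed
  thus ?thesis by (simp add: num_copies_def bij_betw_same_card)
qed

section \<open>The Moon--Moser inequalities\<close>

text \<open>For a clique \<open>Q\<close> and \<open>v \<in> Q\<close> these are the vertices whose only non-neighbour in \<open>Q\<close> is \<open>v\<close>;
  the vertex \<open>v\<close> is one of them. In a complete multipartite graph with one part for each element
  of \<open>Q\<close>, this set is the part of \<open>v\<close>.\<close>

definition missing_only :: "'a graph \<Rightarrow> 'a set \<Rightarrow> 'a \<Rightarrow> 'a set" where
  "missing_only G Q v = common_nbrs G (Q - {v}) - common_nbrs G Q"

lemma missing_only_disjoint:
  "u \<in> Q \<Longrightarrow> v \<in> Q \<Longrightarrow> u \<noteq> v \<Longrightarrow> missing_only G Q u \<inter> missing_only G Q v = {}"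
  by (auto simp: missing_only_def common_nbrs_def)

text \<open>A vertex that misses exactly one element of \<open>Q\<close> is counted once on the right-hand side, and one
  that misses none is counted once for each of the \<open>s\<close> elements.\<close>

lemma card_missing_only_union:
  assumes G: "simple_graph G" and Q: "Q \<in> cliques G s"
  shows "card (\<Union>v\<in>Q. missing_only G Q v) + s * card (common_nbrs G Q) =
         (\<Sum>v\<in>Q. card (common_nbrs G (Q - {v})))"
proof -
  have fin: "finite Q" and s: "card Q = s" using finite_clique[OF G Q] Q by (auto simp: cliques_def)
  have "card (\<Union>v\<in>Q. missing_only G Q v) = (\<Sum>v\<in>Q. card (missing_only G Q v))"
  proof (rule card_UN_disjoint)
    show "\<forall>v\<in>Q. finite (missing_only G Q v)"
      by (simp add: missing_only_def finite_common_nbrs[OF G])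
    show "\<forall>u\<in>Q. \<forall>v\<in>Q. u \<noteq> v \<longrightarrow> missing_only G Q u \<inter> missing_only G Q v = {}"
      by (intro ballI impI missing_only_disjoint)
  qed (rule fin)
  moreover have "card (missing_only G Q v) + card (common_nbrs G Q) =
      card (common_nbrs G (Q - {v}))" for v
  proof -
    have "common_nbrs G Q \<subseteq> common_nbrs G (Q - {v})" by (auto simp: common_nbrs_def)
    thus ?thesis unfolding missing_only_def
      by (metis add.commute card_Diff_subset card_mono finite_common_nbrs[OF G]
          le_add_diff_inverse)
  qed
  hence "(\<Sum>v\<in>Q. card (missing_only G Q v) + card (common_nbrs G Q)) =
      (\<Sum>v\<in>Q. card (common_nbrs G (Q - {v})))" by simp
  ultimately show ?thesis by (simp add: sum.distrib s)
qed

lemma card_missing_only_le: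
  assumes G: "simple_graph G"
  shows "card (\<Union>v\<in>Q. missing_only G Q v) + card (common_nbrs G Q) \<le> card (verts G)"
proof -
  have fin: "finite (verts G)" using G by (simp add: simple_graph_def)
  have sub: "(\<Union>v\<in>Q. missing_only G Q v) \<subseteq> verts G" "common_nbrs G Q \<subseteq> verts G"
    by (auto simp: missing_only_def common_nbrs_def)
  have "card (\<Union>v\<in>Q. missing_only G Q v) + card (common_nbrs G Q) =
      card ((\<Union>v\<in>Q. missing_only G Q v) \<union> common_nbrs G Q)"
    by (rule card_Un_disjoint[symmetric])
       (use finite_subset[OF sub(1) fin] finite_subset[OF sub(2) fin] in
         \<open>auto simp: missing_only_def\<close>)
  also have "\<dots> \<le> card (verts G)" by (rule card_mono) (use fin sub in auto)
  finally show ?thesis .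
qed

text \<open>By double counting, both sides speak of the codegrees \<open>d(P)\<close> of the \<open>s\<close>-cliques \<open>P\<close>: the sum of
  the \<open>d(P)\<close> is \<open>(s+1)\<close> times the number of \<open>(s+1)\<close>-cliques, and the double sum is the
  sum of the \<open>d(P)\<^sup>2\<close>.\<close>

lemma clique_codegree_cauchy_schwarz:
  assumes G: "simple_graph G"
  shows "(Suc s * card (cliques G (Suc s)))\<^sup>2 \<le>
    card (cliques G s) * (\<Sum>Q\<in>cliques G (Suc s). \<Sum>v\<in>Q. card (common_nbrs G (Q - {v})))"
proof -
  have "real (\<Sum>P\<in>cliques G s. card (common_nbrs G P)) ^ 2 \<le>
     (\<Sum>P\<in>cliques G s. (real (card (common_nbrs G P)))\<^sup>2) * card (cliques G s)"
    using sum_squared_le_sum_of_squares[of "\<lambda>P. real (card (common_nbrs G P))" "cliques G s"] by simp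
  hence "real ((\<Sum>P\<in>cliques G s. card (common_nbrs G P)) ^ 2) \<le>
     real ((\<Sum>P\<in>cliques G s. (card (common_nbrs G P))\<^sup>2) * card (cliques G s))"
    by simp
  hence "(\<Sum>P\<in>cliques G s. card (common_nbrs G P)) ^ 2 \<le>
     (\<Sum>P\<in>cliques G s. (card (common_nbrs G P))\<^sup>2) * card (cliques G s)"
    by (rule of_nat_le_iff[THEN iffD1])
  moreover have "(\<Sum>P\<in>cliques G s. (card (common_nbrs G P))\<^sup>2) =
     (\<Sum>Q\<in>cliques G (Suc s). \<Sum>v\<in>Q. card (common_nbrs G (Q - {v})))"
    using sum_flags[OF G, of "\<lambda>P _. card (common_nbrs G P)" s] by (simp add: power2_eq_square)
  ultimately show ?thesis by (simp add: sum_card_common_nbrs[OF G] mult.commute)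
qed

text \<open>Every vertex outside the common neighbourhood of an \<open>(s+1)\<close>-clique \<open>Q\<close> contributes at most one to
  the sum of the codegrees \<open>d(Q - {v})\<close>, and every vertex inside contributes \<open>s + 1\<close>, so that this sum
  is at most \<open>n + s d(Q)\<close>. Summed over \<open>Q\<close>, this bounds the right-hand side of the Cauchy--Schwarz
  estimate.\<close>

lemma moon_moser:
  assumes G: "simple_graph G"
  shows "(Suc s * card (cliques G (Suc s)))\<^sup>2 \<le> card (cliques G s) *
    (card (verts G) * card (cliques G (Suc s)) + s * (Suc (Suc s)) * card (cliques G (Suc (Suc s))))"
proof -
  have "(\<Sum>Q\<in>cliques G (Suc s). \<Sum>v\<in>Q. card (common_nbrs G (Q - {v}))) \<le>
     (\<Sum>Q\<in>cliques G (Suc s). card (verts G) + s * card (common_nbrs G Q))"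
  proof (rule sum_mono)
    fix Q assume "Q \<in> cliques G (Suc s)"
    from card_missing_only_union[OF G this] card_missing_only_le[OF G, of Q]
    show "(\<Sum>v\<in>Q. card (common_nbrs G (Q - {v}))) \<le> card (verts G) + s * card (common_nbrs G Q)"
      by simp
  qed
  also have "\<dots> = card (verts G) * card (cliques G (Suc s)) +
      s * (\<Sum>Q\<in>cliques G (Suc s). card (common_nbrs G Q))"
    by (simp add: sum.distrib sum_distrib_left mult.commute)
  also have "\<dots> = card (verts G) * card (cliques G (Suc s)) +
      s * (Suc (Suc s)) * card (cliques G (Suc (Suc s)))"
    by (simp only: sum_card_common_nbrs[OF G] mult.assoc)
  finally show ?thesis
    by (rule order_trans[OF clique_codegree_cauchy_schwarz[OF G] mult_left_mono]) simp
qed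

section \<open>Few large cliques in graphs without a fixed subgraph\<close>

lemma listset_conv_list_all2: "xs \<in> listset As \<longleftrightarrow> list_all2 (\<in>) xs As"
  by (induction As arbitrary: xs) (auto simp: set_Cons_def list_all2_Cons2)

text \<open>At least the fraction \<open>c/2\<close> of all \<open>x\<close> have \<open>card (D x) \<ge> (c/2) card V\<close>. Each such \<open>D x\<close> contains a
  constant fraction of the \<open>t\<close>-subsets of \<open>V\<close>, so by averaging some \<open>t\<close>-subset lies in a constant
  fraction of all the \<open>D x\<close>.\<close>

lemma popular_subset_exists:
  fixes c :: real and t :: nat and D :: "'b \<Rightarrow> 'a set"
  assumes V: "finite V" and X: "finite X" and c: "c > 0" and t: "t > 0"
    and large: "real t \<le> c / 2 * real (card V)" and tn: "t \<le> card V"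
    and D: "\<And>x. x \<in> X \<Longrightarrow> D x \<subseteq> V"
    and dense: "c * real (card V) * real (card X) \<le> (\<Sum>x\<in>X. real (card (D x)))"
  shows "\<exists>T\<subseteq>V. card T = t \<and>
    c / 2 * (c / (2 * real t)) ^ t * real (card X) \<le> real (card {x\<in>X. T \<subseteq> D x})"
proof -
  define n where "n = card V"
  have n: "real n > 0" using large t c unfolding n_def
    by (metis less_le_trans mult_zero_right of_nat_0_less_iff of_nat_0_le_iff less_le not_less)
  define Gd where "Gd = {x\<in>X. c / 2 * n \<le> card (D x)}"
  have Gd: "finite Gd" "Gd \<subseteq> X" using X by (auto simp: Gd_def)
  have cardD: "card (D x) \<le> n" if "x \<in> X" for x
    unfolding n_def by (rule card_mono[OF V D[OF that]])
  have "(\<Sum>x\<in>X. real (card (D x))) \<le>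
      (\<Sum>x\<in>X. (if x \<in> Gd then real n else 0) + c / 2 * n)"
  proof (rule sum_mono)
    fix x assume x: "x \<in> X"
    have "0 \<le> c / 2 * n" using c by simp
    thus "real (card (D x)) \<le> (if x \<in> Gd then real n else 0) + c / 2 * n"
      using cardD[OF x] x by (auto simp: Gd_def)
  qed
  also have "\<dots> = card Gd * n + card X * (c / 2 * n)"
    using X Gd by (simp add: sum.distrib sum.If_cases Int_absorb1)
  finally have "n * (c / 2 * card X) \<le> n * real (card Gd)"
    using dense by (simp add: n_def algebra_simps)
  hence Gd_card: "c / 2 * card X \<le> card Gd" using n by simp
  define Ts where "Ts = {T. T \<subseteq> V \<and> card T = t}"
  have Ts: "finite Ts" "card Ts = n choose t"
    using V by (simp_all add: Ts_def n_def n_subsets)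
  have Ts_le: "real (card Ts) \<le> real n ^ t"
    using binomial_le_pow[OF tn] unfolding Ts n_def by (metis of_nat_le_iff of_nat_power)
  have many: "(c / (2 * real t)) ^ t * n ^ t \<le> card {T\<in>Ts. T \<subseteq> D x}" if x: "x \<in> Gd" for x
  proof -
    have xX: "x \<in> X" and big: "c / 2 * n \<le> card (D x)" using x by (auto simp: Gd_def)
    have "{T\<in>Ts. T \<subseteq> D x} = {T. T \<subseteq> D x \<and> card T = t}" using D[OF xX] by (auto simp: Ts_def)
    hence eq: "card {T\<in>Ts. T \<subseteq> D x} = card (D x) choose t"
      using finite_subset[OF D[OF xX] V] by (simp add: n_subsets)
    have "t \<le> card (D x)" using large big by (simp add: n_def)
    hence "(real (card (D x)) / t) ^ t \<le> card (D x) choose t"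
      by (rule binomial_ge_n_over_k_pow_k)
    moreover have "(c / (2 * real t) * n) ^ t \<le> (real (card (D x)) / t) ^ t"
    proof (rule power_mono)
      show "c / (2 * real t) * n \<le> card (D x) / t"
        using big t by (simp add: field_simps)
    qed (use c in simp)
    ultimately have "(c / (2 * real t) * real n) ^ t \<le> real (card (D x) choose t)"
      by (rule order_trans[rotated])
    thus ?thesis by (simp only: eq of_nat_power power_mult_distrib)
  qed
  have "(c / 2 * (c / (2 * real t)) ^ t * card X) * card Ts \<le>
      (c / 2 * (c / (2 * real t)) ^ t * card X) * n ^ t"
    by (rule mult_left_mono) (use Ts_le c in auto)
  also have "\<dots> = (c / 2 * card X) * ((c / (2 * real t)) ^ t * n ^ t)" by simp
  also have "\<dots> \<le> card Gd * ((c / (2 * real t)) ^ t * n ^ t)"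
    by (rule mult_right_mono[OF Gd_card]) (use c in simp)
  also have "\<dots> \<le> (\<Sum>x\<in>Gd. real (card {T\<in>Ts. T \<subseteq> D x}))"
    using sum_bounded_below[of Gd "(c / (2 * real t)) ^ t * n ^ t" "\<lambda>x. real (card {T\<in>Ts. T \<subseteq> D x})"] many
    by simp
  also have "\<dots> \<le> (\<Sum>x\<in>X. real (card {T\<in>Ts. T \<subseteq> D x}))"
    by (rule sum_mono2) (use X Gd in auto)
  also have "\<dots> = (\<Sum>T\<in>Ts. real (card {x\<in>X. T \<subseteq> D x}))"
  proof -
    have "(\<Sum>x\<in>X. card {T\<in>Ts. T \<subseteq> D x}) = (\<Sum>T\<in>Ts. card {x\<in>X. T \<subseteq> D x})"
      using sum_multicount_gen[OF X Ts(1), of "\<lambda>x T. T \<subseteq> D x" "\<lambda>T. card {x\<in>X. T \<subseteq> D x}"] by simp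
    thus ?thesis by (simp only: of_nat_sum[symmetric])
  qed
  finally have total: "(c / 2 * (c / (2 * real t)) ^ t * card X) * card Ts \<le>
      (\<Sum>T\<in>Ts. real (card {x\<in>X. T \<subseteq> D x}))" .
  have "card Ts > 0" using tn by (simp add: Ts n_def)
  hence "Ts \<noteq> {}" by auto
  have "\<exists>T\<in>Ts. c / 2 * (c / (2 * real t)) ^ t * card X \<le> card {x\<in>X. T \<subseteq> D x}"
  proof (rule ccontr)
    assume "\<not> ?thesis"
    hence "(\<Sum>T\<in>Ts. real (card {x\<in>X. T \<subseteq> D x})) < (\<Sum>T\<in>Ts. c / 2 * (c / (2 * real t)) ^ t * card X)"
      by (intro sum_strict_mono) (use Ts \<open>Ts \<noteq> {}\<close> in auto)
    with total show False by (simp add: mult.commute)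
  qed
  thus ?thesis by (auto simp: Ts_def)
qed

text \<open>Erdos's theorem on complete \<open>s\<close>-partite \<open>s\<close>-uniform hypergraphs. For the step, \<open>D x\<close> is the set of
  first entries that extend the tuple \<open>x\<close>; a popular \<open>t\<close>-set \<open>T\<close> becomes the first side of the box,
  and the tuples \<open>x\<close> with \<open>T \<subseteq> D x\<close> are again dense.\<close>

lemma dense_tuples_contain_box:
  fixes c :: real and t s :: nat
  assumes t: "t > 0" and c: "c > 0"
  shows "\<exists>n\<^sub>0. \<forall>(V :: 'a set) E. finite V \<and> card V \<ge> n\<^sub>0 \<and>
     E \<subseteq> {xs. set xs \<subseteq> V \<and> length xs = s} \<and> c * real (card V) ^ s \<le> real (card E) \<longrightarrow>
     (\<exists>As. length As = s \<and> (\<forall>A\<in>set As. card A = t) \<and> listset As \<subseteq> E)"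
  using c
proof (induction s arbitrary: c)
  case 0
  have "[] \<in> E" if "E \<subseteq> {xs. set xs \<subseteq> V \<and> length xs = 0}" "c * real (card V) ^ 0 \<le> real (card E)"
    for V :: "'a set" and E
  proof -
    have "card E > 0" using that(2) 0 by (metis less_le_trans mult.right_neutral of_nat_0_less_iff power_0)
    hence "E \<noteq> {}" by auto
    thus ?thesis using that(1) by auto
  qed
  thus ?case by (intro exI[of _ 0]) auto
next
  case (Suc s)
  define c' where "c' = c / 2 * (c / (2 * real t)) ^ t"
  have "c' > 0" using Suc.prems t by (simp add: c'_def)
  from Suc.IH[OF this] obtain n1 where n1:
    "\<forall>(V :: 'a set) E. finite V \<and> card V \<ge> n1 \<and> E \<subseteq> {xs. set xs \<subseteq> V \<and> length xs = s} \<and>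
      c' * real (card V) ^ s \<le> real (card E) \<longrightarrow>
      (\<exists>As. length As = s \<and> (\<forall>A\<in>set As. card A = t) \<and> listset As \<subseteq> E)"
    by (elim exE) (rule that)
  obtain n2 :: nat where n2: "real t / (c / 2) \<le> n2" using real_arch_simple by blast
  show ?case
  proof (intro exI[of _ "max n1 (max n2 t)"] allI impI, elim conjE)
    fix V :: "'a set" and E
    assume V: "finite V" and n: "max n1 (max n2 t) \<le> card V"
      and E: "E \<subseteq> {xs. set xs \<subseteq> V \<and> length xs = Suc s}"
      and dense: "c * real (card V) ^ Suc s \<le> real (card E)"
    define X where "X = {xs. set xs \<subseteq> V \<and> length xs = s}"
    define D where "D x = {v\<in>V. v # x \<in> E}" for x
    have X: "finite X" "card X = card V ^ s"
      using V by (simp_all add: X_def finite_lists_length_eq card_lists_length_eq)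
    have large: "real t \<le> c / 2 * real (card V)"
    proof -
      have "real t / (c / 2) \<le> card V" using n n2 by linarith
      thus ?thesis using Suc.prems by (simp add: field_simps)
    qed
    have form: "\<exists>v x. xs = v # x \<and> v \<in> V \<and> x \<in> X" if "xs \<in> E" for xs
      using subsetD[OF E that] by (cases xs) (auto simp: X_def)
    have "bij_betw (\<lambda>(x, v). v # x) (SIGMA x:X. D x) E"
      by (rule bij_betw_byWitness[where f' = "\<lambda>xs. (tl xs, hd xs)"])
         (use form in \<open>force simp: D_def\<close>)+
    hence "card E = card (SIGMA x:X. D x)" by (metis bij_betw_same_card)
    hence "card E = (\<Sum>x\<in>X. card (D x))" using X V by (simp add: D_def)
    hence "c * real (card V) * real (card X) \<le> (\<Sum>x\<in>X. real (card (D x)))"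
      using dense X by (simp add: algebra_simps)
    from popular_subset_exists[OF V X(1) Suc.prems t large _ _ this]
    obtain T where T: "T \<subseteq> V" "card T = t"
      "c' * real (card X) \<le> real (card {x\<in>X. T \<subseteq> D x})"
      using n unfolding c'_def by (auto simp: D_def)
    have "\<exists>As. length As = s \<and> (\<forall>A\<in>set As. card A = t) \<and> listset As \<subseteq> {x\<in>X. T \<subseteq> D x}"
      by (rule n1[rule_format]) (use V n T X in \<open>auto simp: X_def\<close>)
    then obtain As where "length As = s" "\<forall>A\<in>set As. card A = t" "listset As \<subseteq> {x\<in>X. T \<subseteq> D x}"
      by blast
    thus "\<exists>As. length As = Suc s \<and> (\<forall>A\<in>set As. card A = t) \<and> listset As \<subseteq> E"
      using T by (intro exI[of _ "T # As"]) (auto simp: set_Cons_def D_def)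
  qed
qed

lemma isomorphic_image:
  assumes G: "simple_graph G" and inj: "inj_on f (verts G)"
  shows "isomorphic (Graph (f ` verts G) ((`) f ` edges G)) G"
proof -
  let ?h = "the_inv_into (verts G) f"
  have "{x, y} \<in> (`) f ` edges G \<longleftrightarrow> {?h x, ?h y} \<in> edges G"
    if xy: "x \<in> f ` verts G" "y \<in> f ` verts G" for x y
  proof -
    obtain u v where uv: "u \<in> verts G" "x = f u" "v \<in> verts G" "y = f v"
      using xy by auto
    have h: "?h x = u" "?h y = v" using uv inj by (auto simp: the_inv_into_f_f)
    have "f ` {u, v} \<in> (`) f ` edges G \<longleftrightarrow> {u, v} \<in> edges G"
    proof
      assume "f ` {u, v} \<in> (`) f ` edges G"
      then obtain d where d: "d \<in> edges G" "f ` {u, v} = f ` d" by auto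
      have "d \<subseteq> verts G" using G d by (auto simp: simple_graph_def pairs_of_def)
      hence "{u, v} = d" using inj_on_image_eq_iff[OF inj, of "{u, v}" d] uv d(2) by simp
      thus "{u, v} \<in> edges G" using d by simp
    qed (rule imageI)
    thus ?thesis using h uv by simp
  qed
  moreover have "bij_betw ?h (f ` verts G) (verts G)"
    using inj by (simp add: bij_betw_the_inv_into inj_on_imp_bij_betw)
  ultimately show ?thesis by (auto simp: isomorphic_def)
qed

text \<open>Colour class \<open>i\<close> of \<open>H\<close> is mapped injectively into \<open>As ! i\<close>. Vertices of different colours then
  have adjacent images, and these are distinct because \<open>G\<close> has no loops. The sides have one vertex
  more than \<open>H\<close> merely to be non-empty when \<open>H\<close> has no vertices.\<close>

lemma blowup_not_graph_free:
  fixes G :: "'a graph" and H :: "'b graph"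
  assumes G: "simple_graph G" and H: "simple_graph H" and c: "proper_colouring H k c"
    and As: "length As = k" "\<And>A. A \<in> set As \<Longrightarrow> card A = Suc (card (verts H))"
    and box: "listset As \<subseteq> {xs. set xs \<in> cliques G k \<and> distinct xs}"
  shows "\<not> graph_free H G"
proof -
  have finH: "finite (verts H)" using H by (simp add: simple_graph_def)
  \<comment> \<open>any two of the sides are completely joined\<close>
  have adj: "x \<in> verts G \<and> (i \<noteq> j \<longrightarrow> {x, y} \<in> edges G)"
    if ij: "i < k" "j < k" and xy: "x \<in> As ! i" "y \<in> As ! j" for i j x y
  proof -
    have ne: "As ! l \<noteq> {}" if "l < k" for l
    proof
      assume "As ! l = {}"
      moreover have "As ! l \<in> set As" using that As(1) by simp
      ultimately show False using As(2) by fastforce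
    qed
    \<comment> \<open>a member of the box through \<open>x\<close> and \<open>y\<close>\<close>
    define xs where "xs = map (\<lambda>l. if l = i then x else if l = j then y else SOME z. z \<in> As ! l) [0..<k]"
    have len: "length xs = k" by (simp add: xs_def)
    have "xs ! l \<in> As ! l" if "l < k" for l
      using that xy ne[OF that] some_in_eq by (auto simp: xs_def)
    hence "xs \<in> listset As"
      using As(1) len by (simp add: listset_conv_list_all2 list_all2_conv_all_nth)
    hence cl: "set xs \<in> cliques G k" "distinct xs" using box by auto
    have "xs ! i = x" "i \<noteq> j \<Longrightarrow> xs ! j = y" using ij by (auto simp: xs_def)
    moreover have "xs ! i \<in> set xs" "xs ! j \<in> set xs" using ij len by auto
    moreover have "i \<noteq> j \<Longrightarrow> xs ! i \<noteq> xs ! j" using cl(2) ij len by (simp add: nth_eq_iff_index_eq)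
    ultimately show ?thesis using cl(1) by (auto simp: cliques_def pairs_of_subset_iff)
  qed
  have "\<exists>g. inj_on g (verts H) \<and> g ` verts H \<subseteq> As ! i" if "i < k" for i
  proof -
    have "card (As ! i) = Suc (card (verts H))" using As that by simp
    hence "finite (As ! i)" "card (verts H) \<le> card (As ! i)" by (auto intro: card_ge_0_finite)
    thus ?thesis using card_le_inj[OF finH] by blast
  qed
  then obtain g where g: "\<And>i. i < k \<Longrightarrow> inj_on (g i) (verts H) \<and> g i ` verts H \<subseteq> As ! i"
    by metis
  define f where "f v = g (c v) v" for v
  have ck: "c v < k" if "v \<in> verts H" for v using c that by (simp add: proper_colouring_def)
  have fin: "f v \<in> As ! c v" if "v \<in> verts H" for v
    using g[OF ck[OF that]] that by (auto simp: f_def)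
  have adjf: "{f u, f v} \<in> edges G" if "u \<in> verts H" "v \<in> verts H" "c u \<noteq> c v" for u v
    using adj[OF ck ck fin fin] that by blast
  have inj: "inj_on f (verts H)"
  proof (rule inj_onI)
    fix u v assume uv: "u \<in> verts H" "v \<in> verts H" "f u = f v"
    hence "c u = c v" using adjf[OF uv(1,2)] edge_distinct[OF G] by blast
    thus "u = v" using uv g[OF ck[OF uv(1)]] by (auto simp: f_def inj_on_def)
  qed
  define S where "S = Graph (f ` verts H) ((`) f ` edges H)"
  have edge: "\<exists>u v. e = {u, v} \<and> u \<noteq> v \<and> u \<in> verts H \<and> v \<in> verts H \<and> c u \<noteq> c v"
    if e: "e \<in> edges H" for e
  proof -
    have "e \<in> pairs_of (verts H)" using H e by (auto simp: simple_graph_def)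
    then obtain u v where uv: "e = {u, v}" "u \<noteq> v" "u \<in> verts H" "v \<in> verts H"
      by (auto simp: pairs_of_iff)
    hence "c u \<noteq> c v" using c e by (auto simp: proper_colouring_def)
    with uv show ?thesis by blast
  qed
  have "edges S \<subseteq> edges G" using edge adjf by (fastforce simp: S_def)
  moreover have "edges S \<subseteq> pairs_of (verts S)"
  proof
    fix e assume "e \<in> edges S"
    then obtain d where d: "d \<in> edges H" "e = f ` d" by (auto simp: S_def)
    with edge[OF d(1)] inj show "e \<in> pairs_of (verts S)"
      by (auto simp: S_def pairs_of_iff inj_on_def)
  qed
  moreover have "verts S \<subseteq> verts G"
    using adj[OF ck ck fin fin] by (auto simp: S_def)
  ultimately have "subgraph S G"
    using finH by (auto simp: subgraph_def simple_graph_def S_def)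
  moreover have "isomorphic S H" unfolding S_def by (rule isomorphic_image[OF H inj])
  ultimately show ?thesis by (auto simp: graph_free_def)
qed

text \<open>Orderings of the vertices turn the cliques into tuples. Positive density of these tuples would give a
  complete \<open>k\<close>-partite subgraph with parts larger than \<open>H\<close>.\<close>

lemma graph_free_few_cliques:
  fixes H :: "'b graph" and \<gamma> :: real
  assumes H: "simple_graph H" and c: "proper_colouring H k c" and \<gamma>: "\<gamma> > 0"
  shows "\<exists>n\<^sub>0. \<forall>G :: 'a graph. simple_graph G \<and> graph_free H G \<and> card (verts G) \<ge> n\<^sub>0 \<longrightarrow>
    real (card (cliques G k)) \<le> \<gamma> * real (card (verts G)) ^ k"
proof -
  obtain n0 where n0: "\<forall>(V :: 'a set) E. finite V \<and> card V \<ge> n0 \<and>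
     E \<subseteq> {xs. set xs \<subseteq> V \<and> length xs = k} \<and> \<gamma> * real (card V) ^ k \<le> real (card E) \<longrightarrow>
     (\<exists>As. length As = k \<and> (\<forall>A\<in>set As. card A = Suc (card (verts H))) \<and> listset As \<subseteq> E)"
    using dense_tuples_contain_box[where ?'a = 'a and s = k, OF zero_less_Suc[of "card (verts H)"] \<gamma>]
    by (elim exE) (rule that)
  have "real (card (cliques G k)) \<le> \<gamma> * real (card (verts G)) ^ k"
    if G: "simple_graph G" and free: "graph_free H G" and n: "card (verts G) \<ge> n0" for G :: "'a graph"
  proof (rule ccontr)
    assume many: "\<not> ?thesis"
    define E where "E = {xs. set xs \<in> cliques G k \<and> distinct xs}"
    have V: "finite (verts G)" using G by (simp add: simple_graph_def)
    have E: "E \<subseteq> {xs. set xs \<subseteq> verts G \<and> length xs = k}"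
      by (auto simp: E_def cliques_def distinct_card)
    have finE: "finite E" by (rule finite_subset[OF E]) (rule finite_lists_length_eq[OF V])
    have "cliques G k \<subseteq> set ` E"
    proof
      fix Q assume Q: "Q \<in> cliques G k"
      then obtain xs where "set xs = Q" "distinct xs"
        using finite_distinct_list[OF finite_clique[OF G Q]] by blast
      thus "Q \<in> set ` E" using Q by (auto simp: E_def)
    qed
    hence "card (cliques G k) \<le> card E" by (rule surj_card_le[OF finE])
    hence "\<gamma> * real (card (verts G)) ^ k \<le> real (card E)" using many by linarith
    with n0 V n E have "\<exists>As. length As = k \<and> (\<forall>A\<in>set As. card A = Suc (card (verts H))) \<and>
        listset As \<subseteq> E" by simp
    then obtain As where As: "length As = k" "\<And>A. A \<in> set As \<Longrightarrow> card A = Suc (card (verts H))"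
        "listset As \<subseteq> E" by blast
    from blowup_not_graph_free[OF G H c As(1,2)] As(3) free show False by (simp add: E_def)
  qed
  thus ?thesis by (intro exI[of _ n0]) simp
qed

section \<open>Clique densities\<close>

text \<open>The probability that \<open>s\<close> independent uniformly random colours out of \<open>r\<close> are distinct, which is the
  limit of the clique densities of the Turan graphs.\<close>

definition turan_density :: "nat \<Rightarrow> nat \<Rightarrow> real" where
  "turan_density r s = (\<Prod>i<s. (real r - real i) / real r)"

text \<open>The probability that \<open>s\<close> independent uniformly random vertices form a clique. The factor \<open>fact s\<close>
  accounts for the orderings.\<close>

definition clique_density :: "'a graph \<Rightarrow> nat \<Rightarrow> real" where
  "clique_density G s = fact s * real (card (cliques G s)) / real (card (verts G)) ^ s"

text \<open>What the argument needs to know about the clique densities of a graph. It does not mention the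
  graph, so that densities of graphs of different sizes can be taken to a limit.\<close>

definition moon_moser_seq :: "(nat \<Rightarrow> real) \<Rightarrow> bool" where
  "moon_moser_seq \<tau> \<longleftrightarrow> \<tau> 0 = 1 \<and> \<tau> 1 = 1 \<and> (\<forall>s. 0 \<le> \<tau> s \<and> \<tau> s \<le> 1) \<and>
     (\<forall>s. real (Suc s) * (\<tau> (Suc s))\<^sup>2 \<le> \<tau> s * (\<tau> (Suc s) + real s * \<tau> (Suc (Suc s))))"

lemma moon_moser_seq_clique_density:
  assumes G: "simple_graph G" and n: "card (verts G) > 0"
  shows "moon_moser_seq (clique_density G)"
proof -
  let ?n = "real (card (verts G))" and ?k = "\<lambda>s. real (card (cliques G s))" and ?\<tau> = "clique_density G"
  have n0: "?n > 0" using n by simp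
  have "?\<tau> 0 = 1" by (simp add: clique_density_def cliques_0[OF G])
  moreover have "?\<tau> 1 = 1" using n card_cliques_1[OF G] by (simp add: clique_density_def)
  moreover have "0 \<le> ?\<tau> s" for s by (simp add: clique_density_def)
  moreover have "?\<tau> s \<le> 1" for s
  proof -
    have "real (fact s * card (cliques G s)) \<le> real (card (verts G) ^ s)"
      using fact_cliques_le[OF G] by (rule of_nat_mono)
    thus ?thesis using n0 by (simp add: clique_density_def)
  qed
  moreover have "real (Suc s) * (?\<tau> (Suc s))\<^sup>2 \<le> ?\<tau> s * (?\<tau> (Suc s) + real s * ?\<tau> (Suc (Suc s)))" for s
  proof -
    define f where "f = (fact s :: real)"
    have f: "f > 0" by (simp add: f_def)
    define N where "N = ?n ^ s"
    define a where "a = real (Suc s)"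
    define b where "b = real (Suc (Suc s))"
    have pos: "N > 0" "a > 0" "b > 0" using n0 by (simp_all add: N_def a_def b_def)
    have k: "?k s = ?\<tau> s * (N / f)" "?k (Suc s) = ?\<tau> (Suc s) * (?n * N / f) / a"
      "?k (Suc (Suc s)) = ?\<tau> (Suc (Suc s)) * (?n * ?n * N / f) / (a * b)"
      using n0 by (simp_all add: clique_density_def f_def N_def a_def b_def del: of_nat_Suc)
    have "(a * ?k (Suc s))\<^sup>2 \<le> ?k s * (?n * ?k (Suc s) + real s * b * ?k (Suc (Suc s)))"
      using of_nat_mono[OF moon_moser[OF G, of s], where ?'a = real]
      by (simp only: a_def b_def of_nat_mult of_nat_add of_nat_power)
    also have "a * ?k (Suc s) = ?\<tau> (Suc s) * (?n * N / f)"
      using pos unfolding k by simp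
    also have "real s * b * ?k (Suc (Suc s)) = real s * ?\<tau> (Suc (Suc s)) * (?n * ?n * N / f) / a"
      using pos unfolding k by simp
    also have "?k s * (?n * ?k (Suc s) + real s * ?\<tau> (Suc (Suc s)) * (?n * ?n * N / f) / a) =
        ((?n * N / f)\<^sup>2 / a) * (?\<tau> s * (?\<tau> (Suc s) + real s * ?\<tau> (Suc (Suc s))))"
      unfolding k by (simp add: power2_eq_square add_divide_distrib algebra_simps)
    also have "(?\<tau> (Suc s) * (?n * N / f))\<^sup>2 = ((?n * N / f)\<^sup>2 / a) * (a * (?\<tau> (Suc s))\<^sup>2)"
      using pos by (simp add: power2_eq_square)
    finally have "a * (?\<tau> (Suc s))\<^sup>2 \<le> ?\<tau> s * (?\<tau> (Suc s) + real s * ?\<tau> (Suc (Suc s)))"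
      by (rule mult_left_le_imp_le) (use n0 f pos in simp)
    thus ?thesis by (simp add: a_def)
  qed
  ultimately show ?thesis by (simp add: moon_moser_seq_def)
qed

lemma turan_density_Suc: "turan_density r (Suc s) = turan_density r s * ((real r - real s) / real r)"
  by (simp add: turan_density_def)

lemma turan_density_0: "turan_density r 0 = 1"
  by (simp add: turan_density_def)

lemma turan_density_pos: "s \<le> r \<Longrightarrow> turan_density r s > 0"
  unfolding turan_density_def by (rule prod_pos) auto

lemma tendsto_squeeze_0:
  fixes f g :: "nat \<Rightarrow> real"
  assumes "g \<longlonglongrightarrow> 0" "\<And>k. 0 \<le> f k" "\<And>k. f k \<le> g k"
  shows "f \<longlonglongrightarrow> 0"
  by (rule tendsto_sandwich[of "\<lambda>_. 0" f _ g]) (use assms in auto)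

text \<open>In the Turan graph the ratio of consecutive densities is \<open>(r - s)/r\<close>. Let \<open>u\<^sub>s\<close> be the amount by
  which \<open>\<tau> (s+1)\<close> exceeds this multiple of \<open>\<tau> s\<close>. Then \<open>u\<^sub>r\<close> is the density of
  \<open>(r+1)\<close>-cliques, and inserting the bound for \<open>\<tau> (s+2)\<close> into the Moon--Moser inequality yields
  \<open>u\<^sub>s\<^sup>2 \<le> u\<^bsub>s+1\<^esub>\<close>. Measuring the excess additively avoids dividing by densities for which no lower
  bound is available.\<close>

lemma excess_tendsto_0:
  fixes \<tau> :: "nat \<Rightarrow> nat \<Rightarrow> real"
  assumes mm: "\<And>k. moon_moser_seq (\<tau> k)" and r: "r > 0"
    and lim: "(\<lambda>k. \<tau> k (Suc r)) \<longlonglongrightarrow> 0"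
    and s: "s \<le> r"
  shows "(\<lambda>k. max 0 (\<tau> k (Suc s) - (real r - real s) / real r * \<tau> k s)) \<longlonglongrightarrow> 0"
  using s
proof (induction s rule: inc_induct)
  case base
  have "\<tau> k (Suc r) \<ge> 0" for k using mm[of k] by (simp add: moon_moser_seq_def)
  thus ?case using lim by (simp add: max_absorb2)
next
  case (step s)
  define b where "b i = (real r - real i) / real r" for i
  define u where "u k i = max 0 (\<tau> k (Suc i) - b i * \<tau> k i)" for k i
  have b0: "b s \<ge> 0" using step by (simp add: b_def)
  have "(u k s)\<^sup>2 \<le> u k (Suc s)" for k
  proof -
    let ?t = "\<tau> k"
    have t: "0 \<le> ?t i" "?t i \<le> 1" for i using mm[of k] by (auto simp: moon_moser_seq_def)
    have u0: "u k (Suc s) \<ge> 0" by (simp add: u_def)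
    have "real (Suc s) * (?t (Suc s))\<^sup>2 \<le> ?t s * (?t (Suc s) + real s * ?t (Suc (Suc s)))"
      using mm[of k] by (simp add: moon_moser_seq_def)
    also have "\<dots> \<le> ?t s * (?t (Suc s) + real s * (b (Suc s) * ?t (Suc s) + u k (Suc s)))"
      by (intro mult_left_mono add_left_mono t) (auto simp: u_def t)
    also have "\<dots> = ?t s * ?t (Suc s) * (1 + real s * b (Suc s)) + real s * (?t s * u k (Suc s))"
      by (simp add: algebra_simps)
    also have "1 + real s * b (Suc s) = real (Suc s) * b s"
      using r by (simp add: b_def field_simps)
    also have "real s * (?t s * u k (Suc s)) \<le> real (Suc s) * u k (Suc s)"
      by (intro mult_mono mult_left_le_one_le mult_nonneg_nonneg t u0) auto
    finally have "real (Suc s) * (?t (Suc s) * (?t (Suc s) - b s * ?t s)) \<le> real (Suc s) * u k (Suc s)"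
      by (simp add: algebra_simps power2_eq_square)
    hence *: "?t (Suc s) * (?t (Suc s) - b s * ?t s) \<le> u k (Suc s)"
      by (rule mult_left_le_imp_le) simp
    show ?thesis
    proof (cases "?t (Suc s) - b s * ?t s > 0")
      case True
      have "(?t (Suc s) - b s * ?t s) * (?t (Suc s) - b s * ?t s) \<le> ?t (Suc s) * (?t (Suc s) - b s * ?t s)"
        by (rule mult_right_mono) (use True b0 t in auto)
      from order_trans[OF this *] True show ?thesis
        by (simp add: u_def[of k s] power2_eq_square max_absorb2)
    qed (use u0 in \<open>simp add: u_def\<close>)
  qed
  hence le: "u k s \<le> sqrt (u k (Suc s))" for k by (simp add: real_le_rsqrt)
  have "(\<lambda>k. sqrt (u k (Suc s))) \<longlonglongrightarrow> sqrt 0"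
    using step.IH by (intro tendsto_real_sqrt) (simp add: u_def b_def)
  hence "(\<lambda>k. u k s) \<longlonglongrightarrow> 0"
    by (intro tendsto_squeeze_0[OF _ _ le]) (auto simp: u_def)
  thus ?case by (simp add: u_def b_def)
qed

text \<open>The vanishing excess gives \<open>\<tau> s \<le> turan_density r s + o(1)\<close> for all \<open>s \<le> r\<close>, by induction from
  \<open>\<tau> 0 = 1\<close>. For \<open>s \<le> m\<close> the matching lower bound descends from \<open>s = m\<close>: if \<open>\<tau> (s+1)\<close> is large,
  then \<open>\<tau> s\<close> is large. For \<open>s > m\<close> it ascends, since the Moon--Moser inequality bounds \<open>\<tau> (s+2)\<close> from
  below in terms of \<open>\<tau> s\<close> and \<open>\<tau> (s+1)\<close>, with equality for the Turan densities. The ascent needs two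
  consecutive known densities with a positive index, hence \<open>m \<ge> 2\<close>.\<close>

lemma density_tendsto_turan:
  fixes \<tau> :: "nat \<Rightarrow> nat \<Rightarrow> real"
  assumes mm: "\<And>k. moon_moser_seq (\<tau> k)" and m: "2 \<le> m" "m \<le> r"
    and lim: "(\<lambda>k. \<tau> k (Suc r)) \<longlonglongrightarrow> 0"
    and low: "(\<lambda>k. max 0 (turan_density r m - \<tau> k m)) \<longlonglongrightarrow> 0"
    and s: "s \<le> r"
  shows "(\<lambda>k. \<tau> k s) \<longlonglongrightarrow> turan_density r s"
proof -
  define b where "b i = (real r - real i) / real r" for i
  define T where "T = turan_density r"
  define u where "u i k = max 0 (\<tau> k (Suc i) - b i * \<tau> k i)" for k i
  define v where "v i k = max 0 (\<tau> k i - T i)" for k i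
  define w where "w i k = max 0 (T i - \<tau> k i)" for k i
  have r: "r > 0" using m by simp
  have T: "T (Suc i) = b i * T i" for i by (simp add: T_def b_def turan_density_Suc)
  have Tpos: "T i > 0" if "i \<le> r" for i using that by (simp add: T_def turan_density_pos)
  have b: "b i \<ge> 0" if "i \<le> r" for i using that by (simp add: b_def)
  have bpos: "b i > 0" if "i < r" for i using that by (simp add: b_def)
  have u: "u i \<longlonglongrightarrow> 0" if "i \<le> r" for i
    using excess_tendsto_0[OF mm r lim that] by (simp add: u_def[abs_def] b_def)
  \<comment> \<open>upper bounds for all densities\<close>
  have v: "v i \<longlonglongrightarrow> 0" if "i \<le> r" for i
    using that
  proof (induction i)
    case 0
    have "v 0 k = 0" for k using mm[of k] by (simp add: v_def T_def turan_density_0 moon_moser_seq_def)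
    thus ?case by (intro tendsto_squeeze_0[OF tendsto_const[of 0]]) simp_all
  next
    case (Suc i)
    have lim_bound: "(\<lambda>k. u i k + b i * v i k) \<longlonglongrightarrow> 0"
      using tendsto_add[OF u tendsto_mult_left[OF Suc.IH, of "b i"], of i] Suc.prems by simp
    have bound: "v (Suc i) k \<le> u i k + b i * v i k" for k
    proof -
      have "b i * (\<tau> k i - T i) \<le> b i * v i k"
        by (rule mult_left_mono) (use Suc.prems b in \<open>auto simp: v_def\<close>)
      moreover have "\<tau> k (Suc i) - b i * \<tau> k i \<le> u i k" by (simp add: u_def)
      moreover have "0 \<le> u i k" "0 \<le> b i * v i k" using b Suc.prems by (auto simp: u_def v_def)
      ultimately show ?thesis unfolding v_def[of "Suc i"] T by (simp add: algebra_simps)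
    qed
    show ?case by (rule tendsto_squeeze_0[OF lim_bound _ bound]) (simp add: v_def)
  qed
  \<comment> \<open>lower bounds, descending from \<open>m\<close>\<close>
  have w: "w i \<longlonglongrightarrow> 0" if "i \<le> m" for i
    using that
  proof (induction i rule: inc_induct)
    case base
    show ?case using low by (simp add: w_def[abs_def] T_def)
  next
    case (step i)
    have bi: "b i > 0" using step m by (intro bpos) auto
    have lim_bound: "(\<lambda>k. (w (Suc i) k + u i k) / b i) \<longlonglongrightarrow> 0"
      using tendsto_divide[OF tendsto_add[OF step.IH u, of i] tendsto_const[of "b i"]] step m bi by simp
    have bound: "w i k \<le> (w (Suc i) k + u i k) / b i" for k
    proof -
      have "T (Suc i) - \<tau> k (Suc i) \<le> w (Suc i) k" "\<tau> k (Suc i) - b i * \<tau> k i \<le> u i k"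
        "0 \<le> w (Suc i) k" "0 \<le> u i k" by (simp_all add: w_def u_def)
      hence "T i - \<tau> k i \<le> (w (Suc i) k + u i k) / b i" "0 \<le> (w (Suc i) k + u i k) / b i"
        using bi by (simp_all add: T field_simps)
      thus ?thesis by (simp add: w_def)
    qed
    show ?case by (rule tendsto_squeeze_0[OF lim_bound _ bound]) (simp add: w_def)
  qed
  have vw: "(\<lambda>k. \<tau> k i) \<longlonglongrightarrow> T i" if "v i \<longlonglongrightarrow> 0" "w i \<longlonglongrightarrow> 0" for i
  proof -
    have "(\<lambda>k. T i + v i k - w i k) \<longlonglongrightarrow> T i + 0 - 0" using that by (intro tendsto_intros)
    moreover have "T i + v i k - w i k = \<tau> k i" for k by (simp add: v_def w_def)
    ultimately show ?thesis by simp
  qed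
  have "(\<lambda>k. \<tau> k s) \<longlonglongrightarrow> T s"
    using s
  proof (induction s rule: less_induct)
    case (less s)
    show ?case
    proof (cases "s \<le> m")
      case True
      with less.prems show ?thesis by (intro vw v w)
    next
      case False
      define j where "j = s - 2"
      have j: "s = Suc (Suc j)" "j \<ge> 1" using False m by (auto simp: j_def)
      have lim1: "(\<lambda>k. \<tau> k j) \<longlonglongrightarrow> T j" "(\<lambda>k. \<tau> k (Suc j)) \<longlonglongrightarrow> T (Suc j)"
        using less j by auto
      have Tj: "T j > 0" using j less.prems by (intro Tpos) auto
      have j0: "real j \<noteq> 0" using j by simp
      \<comment> \<open>the lower bound for \<open>\<tau> k s\<close> that the Moon--Moser inequality provides\<close>
      define l where "l k = (real (Suc j) * (\<tau> k (Suc j))\<^sup>2 / \<tau> k j - \<tau> k (Suc j)) / real j" for k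
      have "l \<longlonglongrightarrow> (real (Suc j) * (T (Suc j))\<^sup>2 / T j - T (Suc j)) / real j"
        unfolding l_def using Tj j0 by (intro tendsto_intros lim1) auto
      also have "(real (Suc j) * (T (Suc j))\<^sup>2 / T j - T (Suc j)) / real j = T s"
      proof -
        have "real (Suc j) * (T (Suc j))\<^sup>2 / T j = T (Suc j) * (real (Suc j) * b j)"
          using Tj by (simp add: T[of j] power2_eq_square)
        moreover have "real (Suc j) * b j - 1 = real j * b (Suc j)"
          using r by (simp add: b_def field_simps)
        ultimately have "real (Suc j) * (T (Suc j))\<^sup>2 / T j - T (Suc j) = real j * (b (Suc j) * T (Suc j))"
          by (metis (no_types, opaque_lifting) mult.assoc mult.commute mult.right_neutral right_diff_distrib)
        thus ?thesis using j0 by (simp add: j(1) T[of "Suc j"])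
      qed
      finally have l: "l \<longlonglongrightarrow> T s" .
      have ev: "eventually (\<lambda>k. l k \<le> \<tau> k s) sequentially"
        using order_tendstoD(1)[OF lim1(1) Tj]
      proof eventually_elim
        case (elim k)
        have "real (Suc j) * (\<tau> k (Suc j))\<^sup>2 \<le> \<tau> k j * (\<tau> k (Suc j) + real j * \<tau> k s)"
          using mm[of k] by (simp add: moon_moser_seq_def j(1))
        hence "real (Suc j) * (\<tau> k (Suc j))\<^sup>2 / \<tau> k j \<le> \<tau> k (Suc j) + real j * \<tau> k s"
          using elim by (simp add: pos_divide_le_eq mult.commute)
        thus ?case using j by (simp add: l_def field_simps)
      qed
      have upper: "(\<lambda>k. T s + v s k) \<longlonglongrightarrow> T s + 0"
        using less.prems by (intro tendsto_intros v) auto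
      show ?thesis
      proof (rule tendsto_sandwich[OF ev _ l])
        show "eventually (\<lambda>k. \<tau> k s \<le> T s + v s k) sequentially"
          by (intro always_eventually allI) (simp add: v_def max_def)
      qed (use upper in simp)
    qed
  qed
  thus ?thesis by (simp add: T_def)
qed

text \<open>The quantitative form of the preceding limit: a violation for every \<open>\<delta> = 1/(k+1)\<close> would be a sequence
  that contradicts it.\<close>

lemma density_near_turan:
  assumes m: "2 \<le> m" "m \<le> r" and \<eta>: "\<eta> > (0::real)"
  shows "\<exists>\<delta>>0. \<forall>\<tau>. moon_moser_seq \<tau> \<and> \<tau> (Suc r) \<le> \<delta> \<and> turan_density r m - \<delta> \<le> \<tau> m \<longrightarrow>
    (\<forall>s\<le>r. \<bar>\<tau> s - turan_density r s\<bar> < \<eta>)"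
proof (rule ccontr)
  assume neg: "\<not> ?thesis"
  have "\<exists>\<tau>. moon_moser_seq \<tau> \<and> \<tau> (Suc r) \<le> 1 / real (Suc k) \<and>
      turan_density r m - 1 / real (Suc k) \<le> \<tau> m \<and>
      \<not> (\<forall>s\<le>r. \<bar>\<tau> s - turan_density r s\<bar> < \<eta>)" for k
    using neg by (metis of_nat_0_less_iff zero_less_Suc zero_less_divide_1_iff)
  then obtain \<tau> where \<tau>: "\<And>k. moon_moser_seq (\<tau> k)" "\<And>k. \<tau> k (Suc r) \<le> 1 / real (Suc k)"
      "\<And>k. turan_density r m - 1 / real (Suc k) \<le> \<tau> k m"
      and bad: "\<And>k. \<not> (\<forall>s\<le>r. \<bar>\<tau> k s - turan_density r s\<bar> < \<eta>)"
    by metis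
  have lim0: "(\<lambda>k. 1 / real (Suc k)) \<longlonglongrightarrow> 0" by (rule lim_1_over_n[THEN LIMSEQ_Suc])
  have "(\<lambda>k. \<tau> k s) \<longlonglongrightarrow> turan_density r s" if "s \<le> r" for s
  proof (rule density_tendsto_turan[OF \<tau>(1) m _ _ that])
    show "(\<lambda>k. \<tau> k (Suc r)) \<longlonglongrightarrow> 0"
      using \<tau>(1,2) by (intro tendsto_squeeze_0[OF lim0]) (auto simp: moon_moser_seq_def)
    show "(\<lambda>k. max 0 (turan_density r m - \<tau> k m)) \<longlonglongrightarrow> 0"
      using \<tau>(3) by (intro tendsto_squeeze_0[OF lim0]) (auto simp: algebra_simps)
  qed
  hence "eventually (\<lambda>k. \<bar>\<tau> k s - turan_density r s\<bar> < \<eta>) sequentially" if "s \<le> r" for s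
    using tendstoD[OF _ \<eta>] that by (fastforce simp: dist_real_def)
  hence "eventually (\<lambda>k. \<forall>s\<in>{..r}. \<bar>\<tau> k s - turan_density r s\<bar> < \<eta>) sequentially"
    by (intro eventually_ball_finite) auto
  hence "\<exists>k. \<forall>s\<in>{..r}. \<bar>\<tau> k s - turan_density r s\<bar> < \<eta>"
    unfolding eventually_sequentially by blast
  with bad show False by auto
qed

section \<open>Cliques of the Turan graph\<close>

text \<open>An \<open>s\<close>-clique meets only \<open>s\<close> of the parts and is completely joined to the other \<open>r - s\<close>, each of
  which has at least \<open>n div r\<close> vertices.\<close>

lemma fact_cliques_turan_ge:
  assumes r: "r > 0"
  shows "s \<le> r \<Longrightarrow> turan_density r s * (real r * real (n div r)) ^ s \<le>
    fact s * real (card (cliques (turan_graph r n) s))"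
proof (induction s)
  case 0
  then show ?case using cliques_0[OF simple_turan_graph] by (simp add: turan_density_0)
next
  case (Suc s)
  let ?G = "turan_graph r n"
  note G = simple_turan_graph[of r n]
  have deg: "(r - s) * (n div r) \<le> card (common_nbrs ?G P)" if P: "P \<in> cliques ?G s" for P
  proof -
    \<comment> \<open>the parts that \<open>P\<close> avoids\<close>
    define I where "I = {..<r} - (\<lambda>v. v mod r) ` P"
    have "card ((\<lambda>v. v mod r) ` P) \<le> s"
      using card_image_le[OF finite_clique[OF G P]] P by (auto simp: cliques_def)
    hence cI: "r - s \<le> card I"
      using diff_card_le_card_Diff[of "(\<lambda>v. v mod r) ` P" "{..<r}"] finite_clique[OF G P]
      by (simp add: I_def)
    have "(r - s) * (n div r) \<le> card I * (n div r)" using cI by simp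
    also have "\<dots> \<le> (\<Sum>i\<in>I. card (turan_part r n i))"
      using sum_bounded_below[of I "n div r" "\<lambda>i. card (turan_part r n i)"]
      by (auto simp: I_def turan_part_card)
    also have "\<dots> = card (\<Union>i\<in>I. turan_part r n i)"
      by (rule card_UN_disjoint[symmetric]) (auto simp: I_def turan_part_def)
    also have "\<dots> \<le> card (common_nbrs ?G P)"
    proof (rule card_mono[OF finite_common_nbrs[OF G]])
      show "(\<Union>i\<in>I. turan_part r n i) \<subseteq> common_nbrs ?G P"
        using P by (auto simp: I_def turan_part_def common_nbrs_def turan_graph_edge_iff cliques_def
            turan_graph_def image_iff)
    qed
    finally show ?thesis .
  qed
  have "card (cliques ?G s) * ((r - s) * (n div r)) \<le> (\<Sum>P\<in>cliques ?G s. card (common_nbrs ?G P))"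
    using sum_bounded_below[OF deg] by simp
  also have "\<dots> = Suc s * card (cliques ?G (Suc s))" by (rule sum_card_common_nbrs[OF G])
  finally have "real (card (cliques ?G s) * ((r - s) * (n div r))) \<le> real (Suc s * card (cliques ?G (Suc s)))"
    by (rule of_nat_mono)
  hence step: "real (card (cliques ?G s)) * ((real r - real s) * real (n div r)) \<le>
      real (Suc s) * real (card (cliques ?G (Suc s)))"
    by (simp only: of_nat_mult of_nat_diff[OF Suc_leD[OF Suc.prems]])
  have "turan_density r (Suc s) * (real r * real (n div r)) ^ Suc s =
     (turan_density r s * (real r * real (n div r)) ^ s) * ((real r - real s) * real (n div r))"
    using r by (simp add: turan_density_Suc)
  also have "\<dots> \<le> (fact s * real (card (cliques ?G s))) * ((real r - real s) * real (n div r))"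
    by (rule mult_right_mono) (use Suc in auto)
  also have "\<dots> \<le> fact s * (real (Suc s) * real (card (cliques ?G (Suc s))))"
    using mult_left_mono[OF step, of "fact s"] by (simp add: mult.assoc)
  also have "\<dots> = fact (Suc s) * real (card (cliques ?G (Suc s)))" by simp
  finally show ?case .
qed

lemma clique_density_turan_graph_ge:
  assumes r: "r > 0" and s: "s \<le> r" and \<delta>: "\<delta> > 0"
  shows "\<exists>n\<^sub>0. \<forall>n\<ge>n\<^sub>0. turan_density r s - \<delta> \<le> clique_density (turan_graph r n) s"
proof -
  have "(\<lambda>n. turan_density r s * (1 - real r * inverse (real n)) ^ s) \<longlonglongrightarrow> turan_density r s * (1 - real r * 0) ^ s"
    by (intro tendsto_intros lim_inverse_n)
  hence "eventually (\<lambda>n. turan_density r s - \<delta> < turan_density r s * (1 - real r * inverse (real n)) ^ s) sequentially"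
    using \<delta> by (intro order_tendstoD) auto
  moreover have "eventually (\<lambda>n. n \<ge> r) sequentially" by (rule eventually_ge_at_top)
  ultimately have "eventually (\<lambda>n. turan_density r s - \<delta> \<le> clique_density (turan_graph r n) s) sequentially"
  proof eventually_elim
    case (elim n)
    have n: "real n > 0" using elim r by simp
    have "real n \<le> real r * real (n div r) + real r"
    proof -
      have "n mod r < r" using r by simp
      hence "n \<le> r * (n div r) + r" by (metis add_left_mono less_imp_le mult_div_mod_eq)
      thus ?thesis by (metis of_nat_add of_nat_le_iff of_nat_mult)
    qed
    hence "(real n - real r) ^ s \<le> (real r * real (n div r)) ^ s"
      by (intro power_mono) (use elim in auto)
    hence "turan_density r s * (real n - real r) ^ s \<le> turan_density r s * (real r * real (n div r)) ^ s"
      by (rule mult_left_mono) (use turan_density_pos[OF s] in simp)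
    also have "\<dots> \<le> fact s * real (card (cliques (turan_graph r n) s))"
      by (rule fact_cliques_turan_ge[OF r s])
    finally have "turan_density r s * (real n - real r) ^ s / real n ^ s \<le> clique_density (turan_graph r n) s"
      by (simp add: clique_density_def turan_graph_def divide_right_mono)
    moreover have "(real n - real r) ^ s / real n ^ s = (1 - real r * inverse (real n)) ^ s"
      unfolding power_divide[symmetric] using n by (simp add: field_simps)
    ultimately have "turan_density r s * (1 - real r * inverse (real n)) ^ s
        \<le> clique_density (turan_graph r n) s"
      by (metis times_divide_eq_right)
    with elim(1) show ?case by linarith
  qed
  thus ?thesis by (simp add: eventually_sequentially)
qed

lemma card_pairs_meeting_le:
  assumes "finite V" "W \<subseteq> V"
  shows "card {e \<in> pairs_of V. e \<inter> W \<noteq> {}} \<le> card V * card W"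
proof -
  have "{e \<in> pairs_of V. e \<inter> W \<noteq> {}} \<subseteq> (\<lambda>(u, v). {u, v}) ` (V \<times> W)"
    by (auto simp: pairs_of_iff image_iff)
  hence "card {e \<in> pairs_of V. e \<inter> W \<noteq> {}} \<le> card (V \<times> W)"
    by (rule surj_card_le[rotated]) (use assms in \<open>auto intro: finite_subset\<close>)
  also have "card (V \<times> W) = card V * card W" by (rule card_cartesian_product)
  finally show ?thesis .
qed

section \<open>From an almost proper colouring to the Turan graph\<close>

definition mono_pairs :: "'a set \<Rightarrow> nat \<Rightarrow> ('a \<Rightarrow> nat) \<Rightarrow> 'a set set" where
  "mono_pairs V r c = (\<Union>i<r. pairs_of {v\<in>V. c v = i})"

text \<open>As many vertices of colour \<open>i\<close> as fit are sent into the \<open>i\<close>-th part of the Turan graph; the remaining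
  vertices fill the gaps arbitrarily.\<close>

lemma bij_to_turan_parts:
  assumes V: "finite V" "card V = n" and c: "\<And>v. v \<in> V \<Longrightarrow> c v < r"
  shows "\<exists>f. bij_betw f V {..<n} \<and> card {v\<in>V. f v mod r \<noteq> c v} \<le>
    (\<Sum>i<r. card {v\<in>V. c v = i} - card (turan_part r n i))"
proof -
  define P where "P i = {v\<in>V. c v = i}" for i
  have finP: "finite (P i)" for i using V by (simp add: P_def)
  have finT: "finite (turan_part r n i)" for i by (simp add: turan_part_def)
  have "\<exists>U g. U \<subseteq> P i \<and> inj_on g U \<and> g ` U \<subseteq> turan_part r n i \<and>
      card (P i - U) = card (P i) - card (turan_part r n i)" for i
  proof -
    obtain U where U: "U \<subseteq> P i" "card U = min (card (P i)) (card (turan_part r n i))"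
      using obtain_subset_with_card_n[of "min (card (P i)) (card (turan_part r n i))" "P i"] by auto
    have finU: "finite U" using finP U(1) by (rule finite_subset[rotated])
    have "card U \<le> card (turan_part r n i)" using U by simp
    then obtain g where "inj_on g U" "g ` U \<subseteq> turan_part r n i"
      using card_le_inj[OF finU finT] by blast
    moreover have "card (P i - U) = card (P i) - card (turan_part r n i)"
      using U finU by (simp add: card_Diff_subset)
    ultimately show ?thesis using U by blast
  qed
  then obtain U g where U: "\<And>i. U i \<subseteq> P i" and g: "\<And>i. inj_on (g i) (U i)"
    "\<And>i. g i ` U i \<subseteq> turan_part r n i"
    and diff: "\<And>i. card (P i - U i) = card (P i) - card (turan_part r n i)"
    by metis
  define A where "A = (\<Union>i<r. U i)"
  define g' where "g' v = g (c v) v" for v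
  have AV: "A \<subseteq> V" using U by (auto simp: A_def P_def)
  have in_U: "v \<in> U (c v)" "c v < r" if "v \<in> A" for v
    using that U by (auto simp: A_def P_def)
  have g': "g' v < n" "g' v mod r = c v" if "v \<in> A" for v
    using g(2)[of "c v"] in_U[OF that] by (auto simp: g'_def turan_part_def)
  have inj: "inj_on g' A"
  proof (rule inj_onI)
    fix u v assume uv: "u \<in> A" "v \<in> A" "g' u = g' v"
    hence "c u = c v" using g'(2) by metis
    thus "u = v" using uv in_U[of u] in_U[of v] g(1)[of "c v"] by (auto simp: g'_def inj_on_def)
  qed
  have "card (V - A) = card ({..<n} - g' ` A)"
  proof -
    have "card (V - A) = n - card A"
      using AV V by (metis card_Diff_subset finite_subset)
    moreover have "card ({..<n} - g' ` A) = n - card A"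
      using card_Diff_subset[of "g' ` A" "{..<n}"] finite_subset[OF AV V(1)] g'(1) inj
      by (auto simp: card_image)
    ultimately show ?thesis by simp
  qed
  then obtain h where h: "bij_betw h (V - A) ({..<n} - g' ` A)"
    using finite_same_card_bij[of "V - A" "{..<n} - g' ` A"] V by auto
  define f where "f v = (if v \<in> A then g' v else h v)" for v
  have "bij_betw f A (g' ` A)"
    using inj by (simp add: f_def inj_on_imp_bij_betw cong: bij_betw_cong)
  moreover have "bij_betw f (V - A) ({..<n} - g' ` A)"
    using h bij_betw_cong[of "V - A" f h "{..<n} - g' ` A"] by (simp add: f_def)
  ultimately have "bij_betw f (A \<union> (V - A)) (g' ` A \<union> ({..<n} - g' ` A))"
    by (rule bij_betw_combine) auto
  moreover have "A \<union> (V - A) = V" "g' ` A \<union> ({..<n} - g' ` A) = {..<n}"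
    using AV g'(1) by auto
  ultimately have bij: "bij_betw f V {..<n}" by simp
  have "{v\<in>V. f v mod r \<noteq> c v} \<subseteq> (\<Union>i<r. P i - U i)"
    using g' c by (auto simp: f_def A_def P_def)
  hence "card {v\<in>V. f v mod r \<noteq> c v} \<le> card (\<Union>i<r. P i - U i)"
    by (rule card_mono[rotated]) (simp add: finP)
  also have "\<dots> \<le> (\<Sum>i<r. card (P i - U i))"
    by (rule card_UN_le) simp
  also have "\<dots> = (\<Sum>i<r. card (P i) - card (turan_part r n i))" by (simp only: diff)
  finally show ?thesis using bij unfolding P_def by blast
qed

lemma card_bichromatic_pairs:
  assumes V: "finite V" and c: "\<And>v. v \<in> V \<Longrightarrow> c v < r"
  shows "2 * real (card (pairs_of V - mono_pairs V r c)) =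
    (real (card V))\<^sup>2 - (\<Sum>i<r. (real (card {v\<in>V. c v = i}))\<^sup>2)"
    and "(\<Sum>i<r. real (card {v\<in>V. c v = i})) = real (card V)"
proof -
  define P where "P i = {v\<in>V. c v = i}" for i
  have finP: "finite (P i)" for i using V by (simp add: P_def)
  have pairs: "2 * real (card (pairs_of W)) = (real (card W))\<^sup>2 - real (card W)"
    if "finite W" for W :: "'a set"
  proof -
    have "card (pairs_of W) = card W choose 2"
      using n_subsets[OF that, of 2] by (simp add: pairs_of_def)
    moreover have "even (card W * (card W - 1))" by (cases "card W") auto
    ultimately have "2 * card (pairs_of W) = card W * (card W - 1)"
      by (simp only: choose_two dvd_mult_div_cancel)
    hence "real (2 * card (pairs_of W)) = real (card W * (card W - 1))" by simp
    thus ?thesis by (cases "card W") (auto simp: power2_eq_square algebra_simps)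
  qed
  have fin_pairs: "finite (pairs_of W)" if "finite W" for W :: "'a set"
    by (rule finite_subset[of _ "Pow W"]) (use that in \<open>auto simp: pairs_of_def\<close>)
  have "V = (\<Union>i<r. P i)" using c by (auto simp: P_def)
  hence "card V = (\<Sum>i<r. card (P i))"
    using card_UN_disjoint[of "{..<r}" P] finP by (auto simp: P_def)
  hence sum: "(\<Sum>i<r. real (card (P i))) = real (card V)" by simp
  thus "(\<Sum>i<r. real (card {v\<in>V. c v = i})) = real (card V)" by (simp add: P_def)
  have "card (mono_pairs V r c) = (\<Sum>i<r. card (pairs_of (P i)))"
    unfolding mono_pairs_def P_def[symmetric]
  proof (rule card_UN_disjoint)
    show "\<forall>i\<in>{..<r}. \<forall>j\<in>{..<r}. i \<noteq> j \<longrightarrow> pairs_of (P i) \<inter> pairs_of (P j) = {}"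
      by (auto simp: pairs_of_iff P_def doubleton_eq_iff)
  qed (auto simp: fin_pairs finP)
  hence "2 * real (card (mono_pairs V r c)) = (\<Sum>i<r. 2 * real (card (pairs_of (P i))))"
    by (simp add: sum_distrib_left)
  also have "\<dots> = (\<Sum>i<r. (real (card (P i)))\<^sup>2) - real (card V)"
    by (simp add: pairs finP sum_subtractf sum)
  finally have "2 * real (card (mono_pairs V r c)) = (\<Sum>i<r. (real (card (P i)))\<^sup>2) - real (card V)" .
  moreover have "mono_pairs V r c \<subseteq> pairs_of V"
    by (auto simp: mono_pairs_def pairs_of_def)
  hence "real (card (pairs_of V - mono_pairs V r c)) = real (card (pairs_of V)) - real (card (mono_pairs V r c))"
    using fin_pairs[OF V] by (metis card_Diff_subset card_mono finite_subset of_nat_diff)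
  ultimately show "2 * real (card (pairs_of V - mono_pairs V r c)) =
    (real (card V))\<^sup>2 - (\<Sum>i<r. (real (card {v\<in>V. c v = i}))\<^sup>2)"
    using pairs[OF V] by (simp add: P_def)
qed

text \<open>Since there are few monochromatic edges, there must be almost \<open>(1 - 1/r) n\<^sup>2 / 2\<close> edges between
  different colours. The number of pairs of different colours is \<open>(n\<^sup>2 - \<Sum> p\<^sub>i\<^sup>2)/2\<close>, where the \<open>p\<^sub>i\<close>
  are the sizes of the colour classes, and this is at most \<open>(1 - 1/r) n\<^sup>2 / 2\<close> by convexity.
  So few of these pairs are non-edges, and the variance of the \<open>p\<^sub>i\<close> is small. The colour
  classes can therefore be matched with the Turan parts up to few misplaced vertices. Every edit is a
  monochromatic edge, a missing pair of different colours, or a pair with a misplaced vertex.\<close>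

lemma obtained_by_edits_if_few_mono_edges:
  fixes G :: "'a graph"
  assumes G: "simple_graph G" "card (verts G) = n" and r: "r > 0"
    and c: "\<And>v. v \<in> verts G \<Longrightarrow> c v < r" and \<eta>: "\<eta> \<ge> 0"
    and mono: "real (card (edges G \<inter> mono_pairs (verts G) r c)) \<le> \<eta> * (real n)\<^sup>2"
    and many: "(1 - 1 / real r) * (real n)\<^sup>2 / 2 - \<eta> * (real n)\<^sup>2 \<le> real (card (edges G))"
  shows "obtained_by_edits (turan_graph r n) G
    (3 * \<eta> * (real n)\<^sup>2 + real n * (real r * (2 * sqrt \<eta> * real n + 1)))"
proof -
  define V where "V = verts G"
  define E where "E = edges G"
  define M where "M = mono_pairs V r c"
  define C where "C = pairs_of V - M"
  define p where "p i = real (card {v\<in>V. c v = i})" for i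
  have V: "finite V" "card V = n" using G by (auto simp: V_def simple_graph_def)
  have EV: "E \<subseteq> pairs_of V" using G by (auto simp: E_def V_def simple_graph_def)
  have finE: "finite E" unfolding E_def by (rule finite_edges[OF G(1)])
  have finpairs: "finite (pairs_of V)"
    by (rule finite_subset[of _ "Pow V"]) (use V in \<open>auto simp: pairs_of_def\<close>)
  have finC: "finite C" using finpairs by (simp add: C_def)
  have sizes: "2 * real (card C) = (real n)\<^sup>2 - (\<Sum>i<r. (p i)\<^sup>2)" "(\<Sum>i<r. p i) = real n"
    using card_bichromatic_pairs[OF V(1), of c r] c V by (auto simp: C_def M_def p_def V_def)
  have variance: "(\<Sum>i<r. (p i - real n / real r)\<^sup>2) = (\<Sum>i<r. (p i)\<^sup>2) - (real n)\<^sup>2 / real r"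
  proof -
    have "(\<Sum>i<r. (p i - real n / real r)\<^sup>2) =
        (\<Sum>i<r. (p i)\<^sup>2 - 2 * (real n / real r) * p i + (real n / real r)\<^sup>2)"
      by (intro sum.cong) (auto simp: power2_diff)
    also have "\<dots> = (\<Sum>i<r. (p i)\<^sup>2) - 2 * (real n / real r) * real n + real r * (real n / real r)\<^sup>2"
      by (simp only: sum.distrib sum_subtractf sum_distrib_left[symmetric] sizes(2)) simp
    also have "\<dots> = (\<Sum>i<r. (p i)\<^sup>2) - (real n)\<^sup>2 / real r"
      using r by (simp add: power2_eq_square field_simps)
    finally show ?thesis .
  qed
  have Cle: "real (card C) \<le> (1 - 1 / real r) * (real n)\<^sup>2 / 2"
    using variance sum_nonneg[of "{..<r}" "\<lambda>i. (p i - real n / real r)\<^sup>2"] sizes(1)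
    by (simp add: left_diff_distrib)
  have "card E = card (E \<inter> M) + card (E \<inter> C)"
  proof -
    have "E = (E \<inter> M) \<union> (E \<inter> C)" using EV by (auto simp: C_def)
    moreover have "card ((E \<inter> M) \<union> (E \<inter> C)) = card (E \<inter> M) + card (E \<inter> C)"
      by (rule card_Un_disjoint) (use finE in \<open>auto simp: C_def\<close>)
    ultimately show ?thesis by simp
  qed
  hence EC: "(1 - 1 / real r) * (real n)\<^sup>2 / 2 - 2 * \<eta> * (real n)\<^sup>2 \<le> real (card (E \<inter> C))"
    using mono many by (simp add: E_def M_def V_def)
  have "card (C - E) = card C - card (E \<inter> C)"
    using finC by (metis Diff_Int_distrib2 Int_commute card_Diff_subset_Int finite_Int)
  moreover have ECC: "card (E \<inter> C) \<le> card C" by (rule card_mono) (use finC in auto)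
  ultimately have "real (card (C - E)) = real (card C) - real (card (E \<inter> C))"
    by (simp add: of_nat_diff)
  hence CE: "real (card (C - E)) \<le> 2 * \<eta> * (real n)\<^sup>2"
    using EC Cle by linarith
  have "(\<Sum>i<r. (p i - real n / real r)\<^sup>2) \<le> 4 * \<eta> * (real n)\<^sup>2"
  proof -
    define K where "K = \<eta> * (real n)\<^sup>2"
    define A where "A = (real n)\<^sup>2 / real r"
    have "(1 - 1 / real r) * (real n)\<^sup>2 = (real n)\<^sup>2 - A"
      by (simp add: left_diff_distrib A_def)
    from EC[unfolded this mult.assoc[of _ \<eta>], folded K_def]
    have "((real n)\<^sup>2 - A) / 2 - 2 * K \<le> real (card C)"
      using of_nat_mono[OF ECC, where ?'a = real] by linarith
    hence "(\<Sum>i<r. (p i - real n / real r)\<^sup>2) \<le> 4 * K"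
      unfolding variance A_def[symmetric] using sizes(1) by (simp add: field_simps)
    thus ?thesis by (simp add: K_def)
  qed
  hence dev: "(p i - real n / real r)\<^sup>2 \<le> (2 * sqrt \<eta> * real n)\<^sup>2" if "i < r" for i
    using member_le_sum[of i "{..<r}" "\<lambda>i. (p i - real n / real r)\<^sup>2"] that \<eta>
    by (simp add: power_mult_distrib)
  have p_le: "p i \<le> real n / real r + 2 * sqrt \<eta> * real n" if "i < r" for i
    using power2_le_imp_le[OF dev[OF that]] \<eta> abs_le_square_iff[THEN iffD2, OF dev[OF that]] by simp
  obtain f where f: "bij_betw f V {..<n}" and "card {v\<in>V. f v mod r \<noteq> c v} \<le>
      (\<Sum>i<r. card {v\<in>V. c v = i} - card (turan_part r n i))"
    using bij_to_turan_parts[OF V, of c r] c by (auto simp: V_def)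
  moreover define W where "W = {v\<in>V. f v mod r \<noteq> c v}"
  ultimately have "card W \<le> (\<Sum>i<r. card {v\<in>V. c v = i} - card (turan_part r n i))" by simp
  hence "real (card W) \<le> real (\<Sum>i<r. card {v\<in>V. c v = i} - card (turan_part r n i))"
    by (rule of_nat_mono)
  also have "\<dots> = (\<Sum>i<r. real (card {v\<in>V. c v = i} - card (turan_part r n i)))"
    by (rule of_nat_sum)
  also have "\<dots> \<le> (\<Sum>i<r. 2 * sqrt \<eta> * real n + 1)"
  proof (rule sum_mono)
    fix i assume i: "i \<in> {..<r}"
    have "real n / real r \<le> real (n div r) + 1"
    proof -
      have "n \<le> r * (n div r) + r"
        using mult_div_mod_eq[of r n] mod_less_divisor[OF r, of n] by linarith
      hence "real n \<le> real (r * (n div r) + r)" by (rule of_nat_mono)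
      thus ?thesis using r by (simp add: field_simps)
    qed
    moreover have "real (n div r) \<le> real (card (turan_part r n i))"
      using i by (simp add: turan_part_card)
    moreover have "0 \<le> 2 * sqrt \<eta> * real n + 1" using \<eta> by simp
    ultimately show "real (card {v\<in>V. c v = i} - card (turan_part r n i)) \<le> 2 * sqrt \<eta> * real n + 1"
      using p_le[of i] i
      by (cases "card (turan_part r n i) \<le> card {v\<in>V. c v = i}") (auto simp: p_def of_nat_diff)
  qed
  also have "\<dots> = real r * (2 * sqrt \<eta> * real n + 1)" by simp
  finally have W: "real (card W) \<le> real r * (2 * sqrt \<eta> * real n + 1)" .
  have inj: "inj_on f V" and fV: "f ` V = {..<n}" using f by (auto simp: bij_betw_def)
  define E' where "E' = (`) f ` E"
  define T where "T = edges (turan_graph r n)"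
  \<comment> \<open>the pairs with a misplaced vertex\<close>
  define Z where "Z = {e\<in>pairs_of V. e \<inter> W \<noteq> {}}"
  have E': "E' \<subseteq> pairs_of {..<n}"
  proof
    fix d assume "d \<in> E'"
    then obtain e where e: "e \<in> E" "d = f ` e" by (auto simp: E'_def)
    have "e \<subseteq> V" "card e = 2" using e EV by (auto simp: pairs_of_def)
    thus "d \<in> pairs_of {..<n}"
      using e fV card_image[OF inj_on_subset[OF inj]] by (auto simp: pairs_of_def)
  qed
  have T: "T \<subseteq> pairs_of {..<n}"
    using simple_turan_graph[of r n] by (simp add: T_def simple_graph_def turan_graph_def)
  \<comment> \<open>away from misplaced vertices, the Turan graph joins exactly the pairs of different colours\<close>
  have loc: "f ` {u, v} \<in> T \<longleftrightarrow> {u, v} \<notin> M"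
    if "u \<in> V" "v \<in> V" "u \<noteq> v" "{u, v} \<notin> Z" for u v
  proof -
    have "{u, v} \<in> pairs_of V" using that by (auto simp: pairs_of_iff)
    hence "u \<notin> W" "v \<notin> W" using that by (auto simp: Z_def)
    hence fm: "f u mod r = c u" "f v mod r = c v" using that by (auto simp: W_def)
    have fn: "f u < n" "f v < n" using that fV by auto
    have "{u, v} \<in> M \<longleftrightarrow> c u = c v"
      using that c by (auto simp: M_def mono_pairs_def pairs_of_def V_def)
    thus ?thesis using fm fn turan_graph_edge_iff[of "f u" "f v" r n] by (simp add: T_def)
  qed
  have sub: "(E' - T) \<union> (T - E') \<subseteq> (`) f ` ((E \<inter> M) \<union> (C - E) \<union> Z)"
  proof
    fix d assume d: "d \<in> (E' - T) \<union> (T - E')"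
    hence "d \<in> pairs_of {..<n}" using E' T by auto
    then obtain x y where xy: "x \<in> f ` V" "y \<in> f ` V" "x \<noteq> y" "d = {x, y}"
      unfolding pairs_of_iff fV by auto
    then obtain u v where uv: "u \<in> V" "v \<in> V" "u \<noteq> v" "d = f ` {u, v}" by auto
    have "{u, v} \<in> pairs_of V" using uv by (auto simp: pairs_of_iff)
    moreover have "{u, v} \<in> E \<longleftrightarrow> d \<in> E'"
    proof
      assume "d \<in> E'"
      then obtain e where e: "e \<in> E" "f ` {u, v} = f ` e" using uv by (auto simp: E'_def)
      have "e \<subseteq> V" using e EV by (auto simp: pairs_of_def)
      with e uv inj_on_image_eq_iff[OF inj, of "{u, v}" e] show "{u, v} \<in> E" by simp
    qed (unfold E'_def uv(4), rule imageI)
    ultimately have "{u, v} \<in> (E \<inter> M) \<union> (C - E) \<union> Z"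
      using loc[OF uv(1,2,3)] d uv(4) by (auto simp: C_def)
    thus "d \<in> (`) f ` ((E \<inter> M) \<union> (C - E) \<union> Z)" using uv(4) by blast
  qed
  have "finite ((E \<inter> M) \<union> (C - E) \<union> Z)" using finE finC finpairs by (simp add: Z_def)
  hence "card ((E' - T) \<union> (T - E')) \<le> card ((E \<inter> M) \<union> (C - E) \<union> Z)"
    by (rule surj_card_le) (rule sub)
  also have "\<dots> \<le> card (E \<inter> M) + card (C - E) + card Z"
    by (meson add_le_mono card_Un_le le_refl le_trans)
  also have "\<dots> \<le> card (E \<inter> M) + card (C - E) + n * card W"
    using card_pairs_meeting_le[OF V(1), of W] V(2) by (simp add: Z_def W_def)
  finally have "real (card ((E' - T) \<union> (T - E'))) \<le>
      real (card (E \<inter> M)) + real (card (C - E)) + real n * real (card W)"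
    by (metis of_nat_add of_nat_le_iff of_nat_mult)
  also have "\<dots> \<le> \<eta> * (real n)\<^sup>2 + 2 * \<eta> * (real n)\<^sup>2 + real n * (real r * (2 * sqrt \<eta> * real n + 1))"
    by (intro add_mono mult_left_mono) (use mono CE W in \<open>auto simp: E_def M_def V_def\<close>)
  finally have "real (card ((E' - T) \<union> (T - E'))) \<le>
      3 * \<eta> * (real n)\<^sup>2 + real n * (real r * (2 * sqrt \<eta> * real n + 1))" by simp
  moreover have "isomorphic (Graph {..<n} ((T \<union> (E' - T)) - (T - E'))) G"
  proof -
    have "(T \<union> (E' - T)) - (T - E') = E'" by auto
    thus ?thesis using isomorphic_image[OF G(1), of f] inj fV by (simp add: E'_def E_def V_def)
  qed
  moreover have "verts (turan_graph r n) = {..<n}" by (simp add: turan_graph_def)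
  ultimately show ?thesis
    unfolding obtained_by_edits_def using E'
    by (intro exI[of _ "E' - T"] exI[of _ "T - E'"]) (auto simp: T_def)
qed

section \<open>Partitioning by a typical clique\<close>

text \<open>The vertices that are joined to all of \<open>Q\<close> or miss at least two elements of \<open>Q\<close>.\<close>

definition unclassified :: "'a graph \<Rightarrow> 'a set \<Rightarrow> 'a set" where
  "unclassified G Q = verts G - (\<Union>v\<in>Q. missing_only G Q v)"

definition class_edges :: "'a graph \<Rightarrow> 'a set \<Rightarrow> nat" where
  "class_edges G Q = (\<Sum>v\<in>Q. card {e\<in>edges G. e \<subseteq> missing_only G Q v})"

text \<open>Each vertex that misses exactly one element of \<open>Q\<close> is coloured by that element. The remaining vertices
  receive colour \<open>0\<close>; each of them lies in fewer than \<open>n\<close> monochromatic edges.\<close>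

lemma clique_colouring:
  assumes G: "simple_graph G" and r: "r > 0" and Q: "Q \<in> cliques G r"
  shows "\<exists>c. (\<forall>v\<in>verts G. c v < r) \<and> card (edges G \<inter> mono_pairs (verts G) r c) \<le>
     class_edges G Q + card (verts G) * card (unclassified G Q)"
proof -
  have finQ: "finite Q" using finite_clique[OF G Q] .
  have V: "finite (verts G)" using G by (simp add: simple_graph_def)
  obtain \<phi> where \<phi>: "bij_betw \<phi> Q {..<r}"
    using ex_bij_betw_finite_nat[OF finQ] Q by (auto simp: cliques_def atLeast0LessThan)
  define c where "c w = (if w \<in> unclassified G Q then 0
     else \<phi> (SOME v. v \<in> Q \<and> w \<in> missing_only G Q v))" for w
  have cw: "\<exists>v\<in>Q. w \<in> missing_only G Q v \<and> c w = \<phi> v" if "w \<in> verts G - unclassified G Q" for w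
  proof -
    have "\<exists>v. v \<in> Q \<and> w \<in> missing_only G Q v" using that by (auto simp: unclassified_def)
    from someI_ex[OF this] that show ?thesis by (auto simp: c_def)
  qed
  have "c w < r" if w: "w \<in> verts G" for w
  proof (cases "w \<in> unclassified G Q")
    case False
    then obtain v where "v \<in> Q" "c w = \<phi> v" using cw[of w] w by auto
    thus ?thesis using \<phi> by (auto simp: bij_betw_def)
  qed (use r in \<open>simp add: c_def\<close>)
  moreover have "card (edges G \<inter> mono_pairs (verts G) r c) \<le>
     class_edges G Q + card (verts G) * card (unclassified G Q)"
  proof -
    let ?I = "\<Union>v\<in>Q. {e\<in>edges G. e \<subseteq> missing_only G Q v}"
    let ?B = "{e\<in>pairs_of (verts G). e \<inter> unclassified G Q \<noteq> {}}"
    have "edges G \<inter> mono_pairs (verts G) r c \<subseteq> ?I \<union> ?B"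
    proof
      fix e assume e: "e \<in> edges G \<inter> mono_pairs (verts G) r c"
      then obtain x y where xy: "e = {x, y}" "x \<in> verts G" "y \<in> verts G" "c x = c y" "x \<noteq> y"
        by (auto simp: mono_pairs_def pairs_of_iff)
      show "e \<in> ?I \<union> ?B"
      proof (cases "e \<inter> unclassified G Q = {}")
        case True
        then obtain u v where "u \<in> Q" "x \<in> missing_only G Q u" "c x = \<phi> u"
            "v \<in> Q" "y \<in> missing_only G Q v" "c y = \<phi> v"
          using cw[of x] cw[of y] xy by auto
        moreover from this have "u = v" using \<phi> xy(4) by (auto simp: bij_betw_def inj_on_def)
        ultimately show ?thesis using e xy(1) by auto
      next
        case False
        thus ?thesis using xy by (auto simp: pairs_of_iff)
      qed
    qed
    moreover have "finite (?I \<union> ?B)"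
      by (rule finite_subset[of _ "Pow (verts G)"])
         (use V G in \<open>auto simp: pairs_of_def simple_graph_def\<close>)
    ultimately have "card (edges G \<inter> mono_pairs (verts G) r c) \<le> card (?I \<union> ?B)"
      by (rule card_mono[rotated])
    also have "\<dots> \<le> card ?I + card ?B" by (rule card_Un_le)
    also have "card ?I \<le> class_edges G Q"
      unfolding class_edges_def by (rule card_UN_le[OF finQ])
    also have "card ?B \<le> card (verts G) * card (unclassified G Q)"
      by (rule card_pairs_meeting_le[OF V]) (auto simp: unclassified_def)
    finally show ?thesis by simp
  qed
  ultimately show ?thesis by blast
qed

lemma sum_card_unclassified:
  assumes G: "simple_graph G"
  shows "(\<Sum>Q\<in>cliques G s. card (unclassified G Q)) +
      (\<Sum>Q\<in>cliques G s. \<Sum>v\<in>Q. card (common_nbrs G (Q - {v}))) =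
    card (verts G) * card (cliques G s) + s * (Suc s * card (cliques G (Suc s)))"
proof -
  have V: "finite (verts G)" using G by (simp add: simple_graph_def)
  have "card (unclassified G Q) + (\<Sum>v\<in>Q. card (common_nbrs G (Q - {v}))) =
      card (verts G) + s * card (common_nbrs G Q)" if Q: "Q \<in> cliques G s" for Q
  proof -
    have sub: "(\<Union>v\<in>Q. missing_only G Q v) \<subseteq> verts G"
      by (auto simp: missing_only_def common_nbrs_def)
    have "card (unclassified G Q) + card (\<Union>v\<in>Q. missing_only G Q v) = card (verts G)"
      unfolding unclassified_def
      using card_Diff_subset[OF finite_subset[OF sub V] sub] card_mono[OF V sub] by simp
    with card_missing_only_union[OF G Q] show ?thesis by simp
  qed
  hence "(\<Sum>Q\<in>cliques G s. card (unclassified G Q) + (\<Sum>v\<in>Q. card (common_nbrs G (Q - {v})))) =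
      (\<Sum>Q\<in>cliques G s. card (verts G) + s * card (common_nbrs G Q))" by simp
  also have "\<dots> = card (verts G) * card (cliques G s) + s * (Suc s * card (cliques G (Suc s)))"
    unfolding sum.distrib sum_distrib_left[symmetric] sum_card_common_nbrs[OF G] by simp
  finally show ?thesis by (simp only: sum.distrib)
qed

text \<open>An edge inside the class of \<open>v\<close>, together with \<open>Q - {v}\<close>, is a clique with one vertex more than \<open>Q\<close>.
  For given \<open>P = Q - {v}\<close> there are at most \<open>n\<close> choices of \<open>v\<close>, and a clique \<open>R\<close> arises from at most as
  many pairs of \<open>P\<close> and an edge as it has subsets.\<close>

lemma sum_class_edges_le:
  assumes G: "simple_graph G"
  shows "(\<Sum>Q\<in>cliques G (Suc s). class_edges G Q) \<le>
    card (verts G) * (2 ^ Suc (Suc s) * card (cliques G (Suc (Suc s))))"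
proof -
  have V: "finite (verts G)" using G by (simp add: simple_graph_def)
  define N where "N P = {e\<in>edges G. e \<subseteq> common_nbrs G P}" for P
  have finN: "finite (N P)" for P using finite_edges[OF G] by (simp add: N_def)
  have "(\<Sum>Q\<in>cliques G (Suc s). class_edges G Q) \<le> (\<Sum>Q\<in>cliques G (Suc s). \<Sum>v\<in>Q. card (N (Q - {v})))"
    unfolding class_edges_def
    by (intro sum_mono card_mono finN) (auto simp: N_def missing_only_def)
  also have "\<dots> = (\<Sum>P\<in>cliques G s. \<Sum>v\<in>common_nbrs G P. card (N P))"
    by (rule sum_flags[OF G, symmetric])
  also have "\<dots> = (\<Sum>P\<in>cliques G s. card (common_nbrs G P) * card (N P))" by simp
  also have "\<dots> \<le> (\<Sum>P\<in>cliques G s. card (verts G) * card (N P))"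
    by (intro sum_mono mult_right_mono card_mono V) (auto simp: common_nbrs_def)
  also have "\<dots> = card (verts G) * card (SIGMA P:cliques G s. N P)"
    by (simp add: sum_distrib_left finite_cliques[OF G] finN)
  also have "card (SIGMA P:cliques G s. N P) \<le> card (SIGMA R:cliques G (Suc (Suc s)). Pow R)"
  proof (rule card_inj_on_le)
    have disj: "P \<inter> e = {}" if "e \<in> N P" for P e
      using that common_nbr_notin[OF G] by (auto simp: N_def)
    show "inj_on (\<lambda>(P, e). (P \<union> e, e)) (SIGMA P:cliques G s. N P)"
      by (rule inj_on_inverseI[where g = "\<lambda>(R, e). (R - e, e)"])
         (use disj in \<open>auto simp: Un_Diff Diff_triv\<close>)
    show "(\<lambda>(P, e). (P \<union> e, e)) ` (SIGMA P:cliques G s. N P) \<subseteq> (SIGMA R:cliques G (Suc (Suc s)). Pow R)"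
    proof (rule image_subsetI)
      fix z assume "z \<in> (SIGMA P:cliques G s. N P)"
      then obtain P e where z: "z = (P, e)" and P: "P \<in> cliques G s" and e: "e \<in> N P" by auto
      from e obtain x y where xy: "e = {x, y}" "x \<noteq> y" "{x, y} \<in> edges G"
          "x \<in> common_nbrs G P" "y \<in> common_nbrs G P"
        using G by (auto simp: N_def simple_graph_def pairs_of_iff subset_iff)
      have "y \<in> common_nbrs G (insert x P)" using xy by (auto simp: common_nbrs_def)
      from clique_insert[OF G clique_insert[OF G P xy(4)] this]
      have "P \<union> e \<in> cliques G (Suc (Suc s))" unfolding xy(1) by (simp add: insert_commute)
      thus "(case z of (P, e) \<Rightarrow> (P \<union> e, e)) \<in> (SIGMA R:cliques G (Suc (Suc s)). Pow R)"
        by (simp add: z)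
    qed
    show "finite (SIGMA R:cliques G (Suc (Suc s)). Pow R)"
      by (intro finite_SigmaI finite_cliques[OF G]) (auto intro: finite_clique[OF G])
  qed
  also have "card (SIGMA R:cliques G (Suc (Suc s)). Pow R) = (\<Sum>R\<in>cliques G (Suc (Suc s)). card (Pow R))"
    by (rule card_SigmaI) (auto simp: finite_cliques[OF G] intro: finite_clique[OF G])
  also have "\<dots> = (\<Sum>R\<in>cliques G (Suc (Suc s)). 2 ^ Suc (Suc s))"
  proof (rule sum.cong[OF refl])
    fix R assume R: "R \<in> cliques G (Suc (Suc s))"
    have "card R = Suc (Suc s)" using R by (simp add: cliques_def)
    thus "card (Pow R) = 2 ^ Suc (Suc s)" by (simp only: card_Pow[OF finite_clique[OF G R]])
  qed
  also have "\<dots> = 2 ^ Suc (Suc s) * card (cliques G (Suc (Suc s)))" by simp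
  finally show ?thesis by simp
qed

text \<open>The right-hand side bounds the average of the left-hand side over all \<open>r\<close>-cliques \<open>Q\<close>. The number of
  unclassified vertices is \<open>n + r d(Q)\<close> minus the sum of the codegrees \<open>d(Q - {v})\<close>. By Cauchy--Schwarz
  this sum is on average at least \<open>n r \<tau>\<^sub>r / \<tau>\<^bsub>r-1\<^esub>\<close>, which is \<open>n\<close> for Turan densities. The terms
  \<open>r d(Q)\<close> and \<open>class_edges G Q\<close> are controlled by the number of \<open>(r+1)\<close>-cliques.\<close>

lemma good_clique_exists:
  fixes G :: "'a graph" and p :: nat
  defines "r \<equiv> Suc p" and "n \<equiv> card (verts G)" and "\<tau> \<equiv> clique_density G"
  assumes G: "simple_graph G" and n: "n > 0" and pos: "\<tau> p > 0" "\<tau> r > 0"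
  shows "\<exists>Q\<in>cliques G r. real (class_edges G Q + n * card (unclassified G Q)) \<le>
    (1 - real r * \<tau> r / \<tau> p + (real r + 2 ^ Suc r) * \<tau> (Suc r) / \<tau> r) * (real n)\<^sup>2"
proof -
  define k where "k s = real (card (cliques G s))" for s
  define N where "N = real n"
  define f where "f = (fact p :: real)"
  define R where "R = real r"
  define x where "x Q = real (class_edges G Q + n * card (unclassified G Q))" for Q
  define S where "S = real (\<Sum>Q\<in>cliques G r. \<Sum>v\<in>Q. card (common_nbrs G (Q - {v})))"
  define W where "W = N * k r * (\<tau> (Suc r) / \<tau> r)"
  let ?X = "1 - R * \<tau> r / \<tau> p + (R + 2 ^ Suc r) * \<tau> (Suc r) / \<tau> r"
  have pos': "N > 0" "f > 0" "R > 0" using n by (simp_all add: N_def f_def R_def r_def)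
  have kp: "k p = \<tau> p * N ^ p / f" and kr: "k r = \<tau> r * (N * N ^ p) / (R * f)"
    and kr1: "k (Suc r) = \<tau> (Suc r) * (N * (N * N ^ p)) / ((R + 1) * (R * f))"
  proof -
    have k: "k s = \<tau> s * N ^ s / fact s" for s
      using pos'(1) by (simp add: k_def \<tau>_def clique_density_def N_def n_def)
    have "fact r = R * f" "fact (Suc r) = (R + 1) * (R * f)"
      by (simp_all add: f_def R_def r_def)
    thus "k p = \<tau> p * N ^ p / f" "k r = \<tau> r * (N * N ^ p) / (R * f)"
      "k (Suc r) = \<tau> (Suc r) * (N * (N * N ^ p)) / ((R + 1) * (R * f))"
      using k[of p] k[of r] k[of "Suc r"] by (simp_all only: f_def r_def power_Suc)
  qed
  have kpos: "k p > 0" "k r > 0" unfolding kp kr using pos pos' by simp_all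
  have "real (\<Sum>Q\<in>cliques G r. card (unclassified G Q)) + S = N * k r + R * ((R + 1) * k (Suc r))"
    using arg_cong[OF sum_card_unclassified[OF G, of r], of real]
    by (simp add: S_def N_def n_def k_def R_def algebra_simps)
  moreover have "real (\<Sum>Q\<in>cliques G r. class_edges G Q) \<le> N * (2 ^ Suc r * k (Suc r))"
    using of_nat_mono[OF sum_class_edges_le[OF G, of p], where ?'a = real]
    by (simp add: r_def N_def n_def k_def)
  moreover have "(R * k r)\<^sup>2 \<le> k p * S"
    using of_nat_mono[OF clique_codegree_cauchy_schwarz[OF G, of p], where ?'a = real]
    unfolding of_nat_mult of_nat_power S_def k_def R_def r_def .
  hence "(R * k r)\<^sup>2 / k p \<le> S" using kpos by (simp add: pos_divide_le_eq mult.commute)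
  moreover have "(\<Sum>Q\<in>cliques G r. x Q) = real (\<Sum>Q\<in>cliques G r. class_edges G Q) +
      N * real (\<Sum>Q\<in>cliques G r. card (unclassified G Q))"
    by (simp add: x_def sum.distrib sum_distrib_left N_def)
  ultimately have "(\<Sum>Q\<in>cliques G r. x Q) \<le>
      N * (2 ^ Suc r * k (Suc r)) + N * (N * k r + R * ((R + 1) * k (Suc r)) - (R * k r)\<^sup>2 / k p)"
    using pos' by (smt (verit) mult_left_mono)
  also have "(R * k r)\<^sup>2 / k p = N * k r * (R * \<tau> r / \<tau> p)"
    unfolding kp kr using pos pos' by (simp add: power2_eq_square field_simps)
  also have "k (Suc r) = W / (R + 1)"
    unfolding kr1 kr W_def using pos pos' by (simp add: field_simps)
  also have "R * ((R + 1) * (W / (R + 1))) = R * W" using pos' by simp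
  also have "N * (2 ^ Suc r * (W / (R + 1))) + N * (N * k r + R * W - N * k r * (R * \<tau> r / \<tau> p)) =
     k r * (N\<^sup>2 * (1 - R * \<tau> r / \<tau> p + (R + 2 ^ Suc r / (R + 1)) * (\<tau> (Suc r) / \<tau> r)))"
    by (simp add: W_def power2_eq_square algebra_simps)
  also have "\<dots> \<le> k r * (N\<^sup>2 * ?X)"
  proof -
    have "2 ^ Suc r / (R + 1) \<le> (2 ^ Suc r :: real)"
      using pos' by (simp add: divide_le_eq)
    moreover have "\<tau> (Suc r) / \<tau> r \<ge> 0" using pos by (simp add: \<tau>_def clique_density_def)
    ultimately have "(R + 2 ^ Suc r / (R + 1)) * (\<tau> (Suc r) / \<tau> r) \<le> (R + 2 ^ Suc r) * (\<tau> (Suc r) / \<tau> r)"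
      by (intro mult_right_mono) auto
    thus ?thesis using kpos by (intro mult_left_mono) auto
  qed
  finally have sum: "(\<Sum>Q\<in>cliques G r. x Q) \<le> k r * (N\<^sup>2 * ?X)" .
  have "\<exists>Q\<in>cliques G r. x Q \<le> N\<^sup>2 * ?X"
  proof (rule ccontr)
    assume "\<not> ?thesis"
    moreover have "cliques G r \<noteq> {}" using kpos by (auto simp: k_def)
    ultimately have "(\<Sum>Q\<in>cliques G r. N\<^sup>2 * ?X) < (\<Sum>Q\<in>cliques G r. x Q)"
      by (intro sum_strict_mono finite_cliques[OF G]) auto
    with sum show False by (simp add: k_def)
  qed
  thus ?thesis by (simp add: x_def N_def R_def mult.commute)
qed

text \<open>For \<open>\<tau>\<^sub>s = T\<^sub>s\<close> and \<open>\<tau>\<^bsub>r+1\<^esub> = 0\<close> the bound in the preceding lemma is zero, so for nearby densities some clique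
  colours the graph with few monochromatic edges, and the density of edges is large enough for
  the comparison with the Turan graph.\<close>

lemma near_turan_densities_imp_close:
  fixes r :: nat and \<epsilon> :: real
  assumes r: "r \<ge> 2" and \<epsilon>: "\<epsilon> > 0"
  shows "\<exists>\<eta>>0. \<exists>n\<^sub>0. \<forall>G :: 'a graph. simple_graph G \<and> card (verts G) \<ge> n\<^sub>0 \<and>
     (\<forall>s\<le>r. \<bar>clique_density G s - turan_density r s\<bar> < \<eta>) \<and> clique_density G (Suc r) \<le> \<eta> \<longrightarrow>
     obtained_by_edits (turan_graph r (card (verts G))) G (\<epsilon> * (real (card (verts G)))\<^sup>2)"
proof -
  define p where "p = r - 1"
  have rp: "r = Suc p" "p \<ge> 1" using r by (auto simp: p_def)
  define T where "T = turan_density r r"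
  have T: "T > 0" by (simp add: T_def turan_density_pos)
  have Tp: "turan_density r p = real r * T"
    unfolding T_def using r rp by (simp add: turan_density_Suc)
  \<comment> \<open>With at most \<open>\<mu> n\<^sup>2\<close> monochromatic edges there are at most \<open>(3 \<mu> + 2 r sqrt \<mu>) n\<^sup>2 + r n\<close> edits.
    As \<open>\<mu> \<le> sqrt \<mu> = y\<close>, the quadratic term is at most \<open>(\<epsilon>/2) n\<^sup>2\<close>; the linear one is, for large \<open>n\<close>.\<close>
  define y where "y = min 1 (\<epsilon> / (2 * (3 + 2 * real r)))"
  define \<mu> where "\<mu> = y\<^sup>2"
  have y: "0 < y" "y \<le> 1" using \<epsilon> by (auto simp: y_def)
  have y': "(3 + 2 * real r) * y \<le> \<epsilon> / 2"
  proof -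
    have "y \<le> \<epsilon> / (2 * (3 + 2 * real r))" by (simp add: y_def)
    thus ?thesis by (simp add: field_simps)
  qed
  have \<mu>: "\<mu> > 0" "sqrt \<mu> = y" "\<mu> \<le> y"
    using y by (auto simp: \<mu>_def power2_eq_square mult_le_one mult_left_le)
  define L where "L = real r + 2 ^ Suc r"
  have L: "L > 0" using r by (simp add: L_def add_pos_pos)
  \<comment> \<open>\<open>T/2\<close> keeps \<open>\<tau> (r - 1)\<close> and \<open>\<tau> r\<close> above \<open>T/2\<close>; the last term makes the bound in
    \<open>good_clique_exists\<close> at most \<open>\<mu>\<close>\<close>
  define \<eta> where "\<eta> = min (T / 2) (min \<mu> (\<mu> * T / (2 * (real r + 1 + L))))"
  have \<eta>: "\<eta> > 0" "\<eta> \<le> T / 2" "\<eta> \<le> \<mu>"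
    using T \<mu> L unfolding \<eta>_def by (simp_all only: min.cobounded1 min.coboundedI2) auto
  have \<eta>3: "(real r + 1 + L) * \<eta> \<le> \<mu> * (T / 2)"
  proof -
    have "\<eta> \<le> \<mu> * T / (2 * (real r + 1 + L))" by (simp add: \<eta>_def)
    thus ?thesis using L by (simp add: field_simps)
  qed
  obtain n0 :: nat where n0: "2 * real r / \<epsilon> \<le> real n0" using real_arch_simple by blast
  have "obtained_by_edits (turan_graph r (card (verts G))) G (\<epsilon> * (real (card (verts G)))\<^sup>2)"
    if G: "simple_graph G" and large: "card (verts G) \<ge> max 1 n0"
      and near: "\<And>s. s \<le> r \<Longrightarrow> \<bar>clique_density G s - turan_density r s\<bar> < \<eta>"
      and few: "clique_density G (Suc r) \<le> \<eta>" for G :: "'a graph"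
  proof -
    define n where "n = card (verts G)"
    define \<tau> where "\<tau> = clique_density G"
    have n: "n > 0" "2 * real r / \<epsilon> \<le> real n" using large n0 by (auto simp: n_def)
    have \<tau>r: "\<bar>\<tau> r - T\<bar> < \<eta>" using near[of r] by (simp add: \<tau>_def T_def)
    have \<tau>p: "\<bar>\<tau> p - real r * T\<bar> < \<eta>" using near[of p, unfolded Tp, folded \<tau>_def] rp(1) by simp
    have "T \<le> real r * T" using r T by simp
    hence low: "\<tau> r \<ge> T / 2" "\<tau> p \<ge> T / 2" using \<tau>r \<tau>p \<eta>(2) by linarith+
    have pos: "\<tau> r > 0" "\<tau> p > 0" using low T by linarith+
    have ratio: "1 - real r * \<tau> r / \<tau> p + L * \<tau> (Suc r) / \<tau> r \<le> \<mu>"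
    proof -
      have "real r * (T - \<tau> r) \<le> real r * \<eta>" using \<tau>r by (intro mult_left_mono) auto
      hence "\<tau> p - real r * \<tau> r \<le> (real r + 1) * \<eta>" using \<tau>p by (simp add: algebra_simps)
      hence "(\<tau> p - real r * \<tau> r) / \<tau> p \<le> (real r + 1) * \<eta> / (T / 2)"
        using \<eta>(1) low(2) T by (intro frac_le) auto
      moreover have "L * \<tau> (Suc r) / \<tau> r \<le> L * \<eta> / (T / 2)"
        using few \<eta>(1) low(1) T L by (intro frac_le mult_left_mono) (auto simp: \<tau>_def)
      moreover have "1 - real r * \<tau> r / \<tau> p = (\<tau> p - real r * \<tau> r) / \<tau> p"
        using pos by (simp add: diff_divide_distrib)
      ultimately have "1 - real r * \<tau> r / \<tau> p + L * \<tau> (Suc r) / \<tau> r \<le>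
          (real r + 1) * \<eta> / (T / 2) + L * \<eta> / (T / 2)" by linarith
      also have "\<dots> = (real r + 1 + L) * \<eta> / (T / 2)"
        by (simp only: add_divide_distrib[symmetric] distrib_right[symmetric])
      also have "\<dots> \<le> \<mu>" using \<eta>3 T by (subst pos_divide_le_eq) auto
      finally show ?thesis .
    qed
    obtain Q where Q: "Q \<in> cliques G r" "real (class_edges G Q + n * card (unclassified G Q)) \<le>
        (1 - real r * \<tau> r / \<tau> p + L * \<tau> (Suc r) / \<tau> r) * (real n)\<^sup>2"
      using good_clique_exists[OF G, of p] n pos unfolding \<tau>_def n_def L_def rp(1) by blast
    have "r > 0" using r by simp
    from clique_colouring[OF G this Q(1)] obtain c where c: "\<And>v. v \<in> verts G \<Longrightarrow> c v < r"
      and mono: "card (edges G \<inter> mono_pairs (verts G) r c) \<le> class_edges G Q + n * card (unclassified G Q)"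
      by (auto simp: n_def)
    have "real (card (edges G \<inter> mono_pairs (verts G) r c)) \<le> real (class_edges G Q + n * card (unclassified G Q))"
      by (rule of_nat_mono[OF mono])
    also note Q(2)
    also have "(1 - real r * \<tau> r / \<tau> p + L * \<tau> (Suc r) / \<tau> r) * (real n)\<^sup>2 \<le> \<mu> * (real n)\<^sup>2"
      by (rule mult_right_mono[OF ratio]) simp
    finally have mono': "real (card (edges G \<inter> mono_pairs (verts G) r c)) \<le> \<mu> * (real n)\<^sup>2" .
    have many: "(1 - 1 / real r) * (real n)\<^sup>2 / 2 - \<mu> * (real n)\<^sup>2 \<le> real (card (edges G))"
    proof -
      have "turan_density r 2 = 1 - 1 / real r"
        using r by (simp add: turan_density_def numeral_2_eq_2 diff_divide_distrib)
      hence "1 - 1 / real r - \<mu> \<le> \<tau> 2" using near[OF r] \<eta>(3) by (simp add: \<tau>_def)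
      hence "(1 - 1 / real r - \<mu>) * (real n)\<^sup>2 \<le> \<tau> 2 * (real n)\<^sup>2" by (rule mult_right_mono) simp
      also have "\<dots> = 2 * real (card (edges G))"
        using n by (simp add: \<tau>_def clique_density_def cliques_2[OF G] n_def)
      finally have "(1 - 1 / real r) * (real n)\<^sup>2 - \<mu> * (real n)\<^sup>2 \<le> 2 * real (card (edges G))"
        by (simp add: left_diff_distrib)
      moreover have "\<mu> * (real n)\<^sup>2 \<ge> 0" using \<mu> by simp
      moreover have "x / 2 - y \<le> z" if "x - y \<le> 2 * z" "y \<ge> 0" for x y z :: real
        using that by simp
      ultimately show ?thesis by blast
    qed
    have edits: "obtained_by_edits (turan_graph r n) G
        (3 * \<mu> * (real n)\<^sup>2 + real n * (real r * (2 * sqrt \<mu> * real n + 1)))"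
      by (rule obtained_by_edits_if_few_mono_edges[OF G n_def[symmetric] \<open>r > 0\<close> c _ mono' many])
         (use \<mu> in auto)
    have "3 * \<mu> * (real n)\<^sup>2 + real n * (real r * (2 * sqrt \<mu> * real n + 1)) \<le>
        3 * y * (real n)\<^sup>2 + real n * (real r * (2 * y * real n + 1))"
      unfolding \<mu>(2) by (intro add_right_mono mult_right_mono mult_left_mono) (use \<mu> in auto)
    also have "\<dots> = (3 + 2 * real r) * y * (real n)\<^sup>2 + real r * real n"
      by (simp add: power2_eq_square algebra_simps)
    also have "\<dots> \<le> \<epsilon> / 2 * (real n)\<^sup>2 + \<epsilon> / 2 * real n * real n"
    proof (intro add_mono mult_right_mono y')
      show "real r \<le> \<epsilon> / 2 * real n" using n \<epsilon> by (simp add: field_simps)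
    qed auto
    also have "\<dots> = \<epsilon> * (real n)\<^sup>2" by (simp add: power2_eq_square)
    finally show ?thesis using edits unfolding obtained_by_edits_def n_def
      by (meson order_trans)
  qed
  thus ?thesis using \<eta>(1) by (intro exI[of _ \<eta>] conjI exI[of _ "max 1 n0"]) auto
qed

theorem theorem1p4:
  fixes m r :: nat and H :: "'a graph"
  assumes "m \<ge> 2"
    and "simple_graph H"
    and "chromatic_number H = r + 1"
    and "r + 1 > m"
  shows "\<forall>\<epsilon>::real. \<epsilon> > 0 \<longrightarrow>
    (\<exists>\<delta>::real. \<exists>n\<^sub>0::nat. \<delta> > 0 \<and>
      (\<forall>(G :: 'b graph) n.
         simple_graph G \<and> card (verts G) = n \<and> n \<ge> n\<^sub>0 \<and> graph_free H G \<and>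
         real (num_copies G (complete_graph m))
           \<ge> real (num_copies (turan_graph r n) (complete_graph m)) - \<delta> * real n ^ m
         \<longrightarrow> obtained_by_edits (turan_graph r n) G (\<epsilon> * (real n)\<^sup>2)))"
proof (intro allI impI)
  fix \<epsilon> :: real assume \<epsilon>: "\<epsilon> > 0"
  have m: "2 \<le> m" "m \<le> r" and r: "r \<ge> 2" "r > 0" using assms by auto
  obtain c where c: "proper_colouring H (Suc r) c"
    using chromatic_number_proper[OF assms(2)] assms(3) by auto
  from near_turan_densities_imp_close[OF r(1) \<epsilon>, where ?'a = 'b] obtain \<eta> n1 where \<eta>: "\<eta> > 0"
    and close: "\<forall>G :: 'b graph. simple_graph G \<and> card (verts G) \<ge> n1 \<and>
     (\<forall>s\<le>r. \<bar>clique_density G s - turan_density r s\<bar> < \<eta>) \<and> clique_density G (Suc r) \<le> \<eta> \<longrightarrow>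
     obtained_by_edits (turan_graph r (card (verts G))) G (\<epsilon> * (real (card (verts G)))\<^sup>2)"
    by (elim exE conjE) (rule that)
  from density_near_turan[OF m \<eta>] obtain \<delta>1 where \<delta>1: "\<delta>1 > 0"
    and stable: "\<forall>\<tau>. moon_moser_seq \<tau> \<and> \<tau> (Suc r) \<le> \<delta>1 \<and> turan_density r m - \<delta>1 \<le> \<tau> m \<longrightarrow>
      (\<forall>s\<le>r. \<bar>\<tau> s - turan_density r s\<bar> < \<eta>)"
    by (elim exE conjE) (rule that)
  define \<gamma> where "\<gamma> = min \<delta>1 \<eta>"
  have \<gamma>: "\<gamma> > 0" "\<gamma> \<le> \<delta>1" "\<gamma> \<le> \<eta>" using \<delta>1 \<eta> by (auto simp: \<gamma>_def)
  have "\<gamma> / fact (Suc r) > 0" using \<gamma> by simp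
  from graph_free_few_cliques[OF assms(2) c this, where ?'a = 'b] obtain n2 where
    few: "\<forall>G :: 'b graph. simple_graph G \<and> graph_free H G \<and> card (verts G) \<ge> n2 \<longrightarrow>
      real (card (cliques G (Suc r))) \<le> \<gamma> / fact (Suc r) * real (card (verts G)) ^ Suc r"
    by (elim exE) (rule that)
  \<comment> \<open>One half of \<open>\<delta>1\<close> absorbs the deviation of \<open>T\<^sub>r(n)\<close> from its limit density, the other half is the
    loss that \<open>G\<close> may have. Division by \<open>fact m\<close> converts densities into numbers of unordered cliques.\<close>
  have "\<delta>1 / 2 > 0" using \<delta>1 by simp
  from clique_density_turan_graph_ge[OF r(2) m(2) this] obtain n3 where
    turan: "\<And>n. n \<ge> n3 \<Longrightarrow> turan_density r m - \<delta>1 / 2 \<le> clique_density (turan_graph r n) m"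
    by blast
  show "\<exists>\<delta>::real. \<exists>n\<^sub>0::nat. \<delta> > 0 \<and>
      (\<forall>(G :: 'b graph) n.
         simple_graph G \<and> card (verts G) = n \<and> n \<ge> n\<^sub>0 \<and> graph_free H G \<and>
         real (num_copies G (complete_graph m))
           \<ge> real (num_copies (turan_graph r n) (complete_graph m)) - \<delta> * real n ^ m
         \<longrightarrow> obtained_by_edits (turan_graph r n) G (\<epsilon> * (real n)\<^sup>2))"
  proof (intro exI[of _ "\<delta>1 / 2 / fact m"] exI[of _ "max 1 (max n1 (max n2 n3))"] conjI allI impI,
      use \<delta>1 in simp, elim conjE)
    fix G :: "'b graph" and n
    assume G: "simple_graph G" and n: "card (verts G) = n" and large: "max 1 (max n1 (max n2 n3)) \<le> n"
      and free: "graph_free H G"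
      and copies: "real (num_copies (turan_graph r n) (complete_graph m)) - \<delta>1 / 2 / fact m * real n ^ m
        \<le> real (num_copies G (complete_graph m))"
    let ?\<tau> = "clique_density G"
    have n0: "real n > 0" using large by simp
    have "real (card (cliques G (Suc r))) \<le> \<gamma> / fact (Suc r) * real n ^ Suc r"
      using few[rule_format, of G] G free large n by simp
    hence "fact (Suc r) * real (card (cliques G (Suc r))) \<le> \<gamma> * real n ^ Suc r"
      by (simp add: field_simps del: fact_Suc power_Suc)
    hence "?\<tau> (Suc r) \<le> \<gamma>"
      using n0 by (simp add: clique_density_def n pos_divide_le_eq)
    moreover have "turan_density r m - \<delta>1 \<le> ?\<tau> m"
    proof -
      have "fact m * (real (card (cliques (turan_graph r n) m)) - \<delta>1 / 2 / fact m * real n ^ m) \<le>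
          fact m * real (card (cliques G m))"
        using copies by (intro mult_left_mono)
          (simp_all add: num_copies_complete_graph[OF G] num_copies_complete_graph[OF simple_turan_graph])
      hence "(fact m * real (card (cliques (turan_graph r n) m)) - \<delta>1 / 2 * real n ^ m) / real n ^ m \<le>
          fact m * real (card (cliques G m)) / real n ^ m"
        by (intro divide_right_mono) (simp_all add: right_diff_distrib)
      hence "clique_density (turan_graph r n) m - \<delta>1 / 2 \<le> ?\<tau> m"
        using n0 by (simp add: clique_density_def n turan_graph_def diff_divide_distrib)
      with turan[of n] large show ?thesis by simp
    qed
    moreover have "moon_moser_seq ?\<tau>"
      using large n by (intro moon_moser_seq_clique_density[OF G]) simp
    ultimately show "obtained_by_edits (turan_graph r n) G (\<epsilon> * (real n)\<^sup>2)"
      using close[rule_format, of G] stable[rule_format, of ?\<tau>] G \<gamma> large n by simp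
  qed
qed

end
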